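(* Let $n\ge 2$ and let $\psi:M\to\overline M$ be an $n$-dimensional maximal hypersurface immersed in a GRW spacetime $\overline M=I\times_f F$ with Ricci-flat fiber that obeys the Null Convergence Condition. Then, on $M$, $$\frac12\,\Delta\sinh^2\varphi\;\ge\;\left((n+1)\frac{f'(\tau)^2}{f(\tau)^2}-n\frac{f''(\tau)}{f(\tau)}\right)\sinh^4\varphi,$$ where $\varphi$ is the hyperbolic angle function of $M$, $\tau=\pi_I\circ\psi$, and $\Delta$ is the Laplacian of the induced metric on $M$.
   Context: Let $(F,g_F)$ be a connected $n$-dimensional Riemannian manifold ($n\ge 2$), $I\subseteq\mathbb{R}$ an open interval with metric $-dt^2$, and $f:I\to(0,\infty)$ a smooth function. The Generalized Robertson-Walker (GRW) spacetime $I\times_f F$ with fiber $F$ and warping function $f$ is the product manifold $I\times F$ with Lorentzian metric $\bar g=-\pi_I^*(dt^2)+f(\pi_I)^2\,\pi_F^*(g_F)$, where $\pi_I,\pi_F$ are the projections, time-oriented by $\partial_t=\partial/\partial t$. The spacetime obeys the Null Convergence Condition if its Ricci tensor satisfies $\overline{\mathrm{Ric}}(z,z)\ge 0$ for all null vectors $z$. A spacelike hypersurface is an immersion $\psi:M\to\overline M$ of an $n$-dimensional manifold $M$ such that the induced metric $g_M=\psi^*\bar g$ is Riemannian. Let $N$ be the unit timelike normal vector field along $\psi$ with the same time-orientation as $\partial_t$ (so $\bar g(N,\partial_t)\le -1$), $AX=-\overline\nabla_X N$ the shape operator ($\overline\nabla$ the Levi-Civita connection of $\bar g$), and $H=-\frac1n\mathrm{trace}(A)$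 the mean curvature. The hypersurface is maximal if $H\equiv 0$. The hyperbolic angle function $\varphi$ on $M$ is defined by $\cosh\varphi=-\bar g(N,\partial_t)$, $\varphi\ge 0$; thus $\sinh^2\varphi=\bar g(N,\partial_t)^2-1$. The Laplacian is $\Delta u=\mathrm{div}(\nabla u)$ for $g_M$. *)

theory Defs
  imports "HOL-Analysis.Analysis"
begin

text \<open>Smooth maps between open subsets of Euclidean spaces.  All sets \<open>S\<close> below are open, so that
  \<open>at x\<close> and \<open>at x within S\<close> give the same derivatives.\<close>

abbreviation dd :: "('a::real_normed_vector \<Rightarrow> 'b::real_normed_vector) \<Rightarrow> 'a \<Rightarrow> 'a \<Rightarrow> 'b"
  where "dd f x u \<equiv> frechet_derivative f (at x) u"

primrec Ck_on :: "nat \<Rightarrow> 'a::euclidean_space set \<Rightarrow> ('a \<Rightarrow> 'b::real_normed_vector) \<Rightarrow> bool" where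
  "Ck_on 0 S f \<longleftrightarrow> continuous_on S f"
| "Ck_on (Suc k) S f \<longleftrightarrow>
     (\<forall>x\<in>S. f differentiable (at x)) \<and> (\<forall>u. Ck_on k S (\<lambda>x. dd f x u))"

definition smooth_on :: "'a::euclidean_space set \<Rightarrow> ('a \<Rightarrow> 'b::real_normed_vector) \<Rightarrow> bool"
  where "smooth_on S f \<longleftrightarrow> (\<forall>k. Ck_on k S f)"


text \<open>A smooth manifold of dimension \<open>DIM('a)\<close> is a topological space together with an indexed
  smooth atlas with values in the model space \<open>'a\<close>.  Tangent vectors and tensors at a point are
  given by their components with respect to each chart of the atlas, subject to the usual
  transformation law under change of charts.\<close>

record ('i, 'm, 'a) manifold =
  pts :: "'m topology"
  charts :: "'i set"
  chart_dom :: "'i \<Rightarrow> 'm set"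
  coord :: "'i \<Rightarrow> 'm \<Rightarrow> 'a"

definition img :: "('i, 'm, 'a) manifold \<Rightarrow> 'i \<Rightarrow> 'a set"
  where "img M i = coord M i ` chart_dom M i"

definition param :: "('i, 'm, 'a) manifold \<Rightarrow> 'i \<Rightarrow> 'a \<Rightarrow> 'm"
  where "param M i = inv_into (chart_dom M i) (coord M i)"

definition transition :: "('i, 'm, 'a) manifold \<Rightarrow> 'i \<Rightarrow> 'i \<Rightarrow> 'a \<Rightarrow> 'a"
  where "transition M i k = coord M k \<circ> param M i"

definition smooth_manifold :: "('i, 'm, 'a::euclidean_space) manifold \<Rightarrow> bool"
  where "smooth_manifold M \<longleftrightarrow>
    Hausdorff_space (pts M) \<and> second_countable (pts M) \<and>
    (\<Union>i\<in>charts M. chart_dom M i) = topspace (pts M) \<and>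
    (\<forall>i\<in>charts M. openin (pts M) (chart_dom M i) \<and> open (img M i) \<and>
       homeomorphic_map (subtopology (pts M) (chart_dom M i)) (top_of_set (img M i)) (coord M i)) \<and>
    (\<forall>i\<in>charts M. \<forall>k\<in>charts M.
       smooth_on (coord M i ` (chart_dom M i \<inter> chart_dom M k)) (transition M i k))"

text \<open>\<open>g i x u v\<close> is the value at the point with coordinates \<open>x\<close> in the chart \<open>i\<close> of a
  (0,2)-tensor on the vectors with components \<open>u\<close> and \<open>v\<close>.\<close>

type_synonym ('i, 'a) tensor2 = "'i \<Rightarrow> 'a \<Rightarrow> 'a \<Rightarrow> 'a \<Rightarrow> real"

definition smooth_tensor2 ::
    "('i, 'm, 'a::euclidean_space) manifold \<Rightarrow> ('i, 'a) tensor2 \<Rightarrow> bool"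
  where "smooth_tensor2 M g \<longleftrightarrow>
    (\<forall>i\<in>charts M. (\<forall>x\<in>img M i. bilinear (g i x)) \<and>
       (\<forall>u v. smooth_on (img M i) (\<lambda>x. g i x u v))) \<and>
    (\<forall>i\<in>charts M. \<forall>k\<in>charts M. \<forall>x\<in>coord M i ` (chart_dom M i \<inter> chart_dom M k). \<forall>u v.
       g i x u v =
         g k (transition M i k x) (dd (transition M i k) x u) (dd (transition M i k) x v))"

definition riemannian_metric ::
    "('i, 'm, 'a::euclidean_space) manifold \<Rightarrow> ('i, 'a) tensor2 \<Rightarrow> bool"
  where "riemannian_metric M g \<longleftrightarrow> smooth_tensor2 M g \<and>
    (\<forall>i\<in>charts M. \<forall>x\<in>img M i.
       (\<forall>u v. g i x u v = g i x v u) \<and> (\<forall>u. u \<noteq> 0 \<longrightarrow> g i x u u > 0))"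


text \<open>Local formulas for a nondegenerate symmetric \<open>h :: 'a \<Rightarrow> 'a \<Rightarrow> 'a \<Rightarrow> real\<close> on an open subset of
  \<open>'a\<close>.  The Christoffel symbols are defined by the Koszul formula for constant vector fields,
  and \<open>covariant_derivative_along h P V x u\<close> is the Levi-Civita derivative of a vector field \<open>V\<close>
  along a map \<open>P\<close>.\<close>

definition christoffel :: "('a::euclidean_space \<Rightarrow> 'a \<Rightarrow> 'a \<Rightarrow> real) \<Rightarrow> 'a \<Rightarrow> 'a \<Rightarrow> 'a \<Rightarrow> 'a"
  where "christoffel h x u v = (THE w. \<forall>z. h x w z =
    (dd (\<lambda>y. h y v z) x u + dd (\<lambda>y. h y u z) x v - dd (\<lambda>y. h y u v) x z) / 2)"

definition covariant_derivative_along ::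
    "('a::euclidean_space \<Rightarrow> 'a \<Rightarrow> 'a \<Rightarrow> real) \<Rightarrow> ('b::euclidean_space \<Rightarrow> 'a) \<Rightarrow> ('b \<Rightarrow> 'a)
      \<Rightarrow> 'b \<Rightarrow> 'b \<Rightarrow> 'a"
  where "covariant_derivative_along h P V x u = dd V x u + christoffel h (P x) (dd P x u) (V x)"

text \<open>\<open>curvature h x u v w\<close> is R(u,v)w with the convention
  \<open>R(X,Y)Z = \<nabla>\<^sub>X \<nabla>\<^sub>Y Z - \<nabla>\<^sub>Y \<nabla>\<^sub>X Z - \<nabla>\<^bsub>[X,Y]\<^esub> Z\<close>, so that round spheres have positive Ricci
  curvature.\<close>

definition curvature :: "('a::euclidean_space \<Rightarrow> 'a \<Rightarrow> 'a \<Rightarrow> real) \<Rightarrow> 'a \<Rightarrow> 'a \<Rightarrow> 'a \<Rightarrow> 'a \<Rightarrow> 'a"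
  where "curvature h x u v w =
    dd (\<lambda>y. christoffel h y v w) x u - dd (\<lambda>y. christoffel h y u w) x v
    + christoffel h x u (christoffel h x v w) - christoffel h x v (christoffel h x u w)"

text \<open>The trace of an endomorphism does not depend on any metric; here it is computed in the
  standard basis of the model space.\<close>

definition endo_trace :: "('a::euclidean_space \<Rightarrow> 'a) \<Rightarrow> real"
  where "endo_trace L = (\<Sum>b\<in>Basis. L b \<bullet> b)"

definition ricci :: "('a::euclidean_space \<Rightarrow> 'a \<Rightarrow> 'a \<Rightarrow> real) \<Rightarrow> 'a \<Rightarrow> 'a \<Rightarrow> 'a \<Rightarrow> real"
  where "ricci h x v w = endo_trace (\<lambda>u. curvature h x u v w)"

definition gradient :: "('a::euclidean_space \<Rightarrow> 'a \<Rightarrow> 'a \<Rightarrow> real) \<Rightarrow> ('a \<Rightarrow> real) \<Rightarrow> 'a \<Rightarrow> 'a"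
  where "gradient h u x = (THE w. \<forall>z. h x w z = dd u x z)"

definition divergence :: "('a::euclidean_space \<Rightarrow> 'a \<Rightarrow> 'a \<Rightarrow> real) \<Rightarrow> ('a \<Rightarrow> 'a) \<Rightarrow> 'a \<Rightarrow> real"
  where "divergence h X x = endo_trace (covariant_derivative_along h (\<lambda>y. y) X x)"

text \<open>\<open>laplacian M g j u p\<close> is the Laplacian of \<open>u\<close> at \<open>p\<close>, computed in a chart \<open>j\<close> around \<open>p\<close>.\<close>

definition laplacian ::
    "('i, 'm, 'a::euclidean_space) manifold \<Rightarrow> ('i, 'a) tensor2 \<Rightarrow> 'i \<Rightarrow> ('m \<Rightarrow> real) \<Rightarrow> 'm \<Rightarrow> real"
  where "laplacian M g j u p =
    divergence (g j) (gradient (g j) (u \<circ> param M j)) (coord M j p)"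


text \<open>Ricci-flatness and the null convergence condition are tensorial, so asking for them in all
  charts is the same as asking for them in one chart around each point.\<close>

definition ricci_flat :: "('i, 'm, 'a::euclidean_space) manifold \<Rightarrow> ('i, 'a) tensor2 \<Rightarrow> bool"
  where "ricci_flat M g \<longleftrightarrow>
    (\<forall>i\<in>charts M. \<forall>x\<in>img M i. \<forall>v w. ricci (g i) x v w = 0)"

definition null_convergence_condition ::
    "('i, 'm, 'a::euclidean_space) manifold \<Rightarrow> ('i, 'a) tensor2 \<Rightarrow> bool"
  where "null_convergence_condition M g \<longleftrightarrow>
    (\<forall>i\<in>charts M. \<forall>x\<in>img M i. \<forall>z. g i x z z = 0 \<longrightarrow> ricci (g i) x z z \<ge> 0)"


text \<open>The spacetime carries the product atlas: each chart of the fiber gives a chart of the product,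
  with the same index.\<close>

definition interval_product ::
    "real set \<Rightarrow> ('i, 'm, 'a) manifold \<Rightarrow> ('i, real \<times> 'm, real \<times> 'a) manifold"
  where "interval_product I F =
    \<lparr>pts = prod_topology (top_of_set I) (pts F), charts = charts F,
     chart_dom = (\<lambda>i. I \<times> chart_dom F i), coord = (\<lambda>i (t, p). (t, coord F i p))\<rparr>"

definition grw_metric :: "(real \<Rightarrow> real) \<Rightarrow> ('i, 'a) tensor2 \<Rightarrow> ('i, real \<times> 'a) tensor2"
  where "grw_metric f g = (\<lambda>i (t, x) (a, u) (b, v). - (a * b) + (f t)\<^sup>2 * g i x u v)"

text \<open>The components of \<open>\<partial>\<^sub>t\<close> are the same in every chart of the product.\<close>

definition grw_dt :: "real \<times> 'a::zero"
  where "grw_dt = (1, 0)"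


text \<open>In the following, \<open>j\<close> is a chart of \<open>M\<close> and \<open>i\<close> is a chart of the ambient manifold \<open>S\<close>.  The
  coordinate expression of \<open>\<psi>\<close> is only meaningful on \<open>local_dom\<close>.\<close>

definition local_dom ::
    "('j, 'm, 'b) manifold \<Rightarrow> ('i, 's, 'a) manifold \<Rightarrow> ('m \<Rightarrow> 's) \<Rightarrow> 'j \<Rightarrow> 'i \<Rightarrow> 'b set"
  where "local_dom M S \<psi> j i = coord M j ` {p \<in> chart_dom M j. \<psi> p \<in> chart_dom S i}"

definition local_rep ::
    "('j, 'm, 'b) manifold \<Rightarrow> ('i, 's, 'a) manifold \<Rightarrow> ('m \<Rightarrow> 's) \<Rightarrow> 'j \<Rightarrow> 'i \<Rightarrow> 'b \<Rightarrow> 'a"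
  where "local_rep M S \<psi> j i = coord S i \<circ> \<psi> \<circ> param M j"

definition immersion ::
    "('j, 'm, 'b::euclidean_space) manifold \<Rightarrow> ('i, 's, 'a::euclidean_space) manifold
      \<Rightarrow> ('m \<Rightarrow> 's) \<Rightarrow> bool"
  where "immersion M S \<psi> \<longleftrightarrow> continuous_map (pts M) (pts S) \<psi> \<and>
    (\<forall>j\<in>charts M. \<forall>i\<in>charts S.
       smooth_on (local_dom M S \<psi> j i) (local_rep M S \<psi> j i) \<and>
       (\<forall>x\<in>local_dom M S \<psi> j i. inj (dd (local_rep M S \<psi> j i) x)))"

definition induced_metric ::
    "('j, 'm, 'b::euclidean_space) manifold \<Rightarrow> ('i, 's, 'a::euclidean_space) manifold
      \<Rightarrow> ('i, 'a) tensor2 \<Rightarrow> ('m \<Rightarrow> 's) \<Rightarrow> ('j, 'b) tensor2 \<Rightarrow> bool"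
  where "induced_metric M S h \<psi> g \<longleftrightarrow>
    (\<forall>j\<in>charts M. \<forall>i\<in>charts S. \<forall>x\<in>local_dom M S \<psi> j i. \<forall>u v.
       g j x u v = h i (local_rep M S \<psi> j i x)
         (dd (local_rep M S \<psi> j i) x u) (dd (local_rep M S \<psi> j i) x v))"

definition spacelike_immersion ::
    "('j, 'm, 'b::euclidean_space) manifold \<Rightarrow> ('i, 's, 'a::euclidean_space) manifold
      \<Rightarrow> ('i, 'a) tensor2 \<Rightarrow> ('m \<Rightarrow> 's) \<Rightarrow> ('j, 'b) tensor2 \<Rightarrow> bool"
  where "spacelike_immersion M S h \<psi> g \<longleftrightarrow>
    immersion M S \<psi> \<and> induced_metric M S h \<psi> g \<and> riemannian_metric M g"

text \<open>\<open>N i p\<close> are the components in the chart \<open>i\<close> of a tangent vector of \<open>S\<close> at \<open>\<psi> p\<close>.\<close>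

definition vector_field_along ::
    "('j, 'm, 'b::euclidean_space) manifold \<Rightarrow> ('i, 's, 'a::euclidean_space) manifold
      \<Rightarrow> ('m \<Rightarrow> 's) \<Rightarrow> ('i \<Rightarrow> 'm \<Rightarrow> 'a) \<Rightarrow> bool"
  where "vector_field_along M S \<psi> N \<longleftrightarrow>
    (\<forall>j\<in>charts M. \<forall>i\<in>charts S. smooth_on (local_dom M S \<psi> j i) (N i \<circ> param M j)) \<and>
    (\<forall>i\<in>charts S. \<forall>k\<in>charts S. \<forall>p\<in>topspace (pts M). \<psi> p \<in> chart_dom S i \<inter> chart_dom S k \<longrightarrow>
       N k p = dd (transition S i k) (coord S i (\<psi> p)) (N i p))"

definition unit_timelike_normal ::
    "('j, 'm, 'b::euclidean_space) manifold \<Rightarrow> ('i, 's, 'a::euclidean_space) manifold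
      \<Rightarrow> ('i, 'a) tensor2 \<Rightarrow> ('m \<Rightarrow> 's) \<Rightarrow> ('i \<Rightarrow> 'm \<Rightarrow> 'a) \<Rightarrow> bool"
  where "unit_timelike_normal M S h \<psi> N \<longleftrightarrow> vector_field_along M S \<psi> N \<and>
    (\<forall>j\<in>charts M. \<forall>i\<in>charts S. \<forall>x\<in>local_dom M S \<psi> j i.
       h i (local_rep M S \<psi> j i x) (N i (param M j x)) (N i (param M j x)) = -1 \<and>
       (\<forall>u. h i (local_rep M S \<psi> j i x) (N i (param M j x)) (dd (local_rep M S \<psi> j i) x u) = 0))"

text \<open>\<open>AX = - \<nabla>\<^sub>X N\<close>, where a tangent vector of \<open>M\<close> is identified with its image under the (injective)
  differential of \<open>\<psi>\<close>.\<close>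

definition shape_operator ::
    "('j, 'm, 'b::euclidean_space) manifold \<Rightarrow> ('i, 's, 'a::euclidean_space) manifold
      \<Rightarrow> ('i, 'a) tensor2 \<Rightarrow> ('m \<Rightarrow> 's) \<Rightarrow> ('i \<Rightarrow> 'm \<Rightarrow> 'a) \<Rightarrow> 'j \<Rightarrow> 'i \<Rightarrow> 'b \<Rightarrow> 'b \<Rightarrow> 'b"
  where "shape_operator M S h \<psi> N j i x u =
    (THE w. dd (local_rep M S \<psi> j i) x w =
       - covariant_derivative_along (h i) (local_rep M S \<psi> j i) (N i \<circ> param M j) x u)"

definition mean_curvature ::
    "('j, 'm, 'b::euclidean_space) manifold \<Rightarrow> ('i, 's, 'a::euclidean_space) manifold
      \<Rightarrow> ('i, 'a) tensor2 \<Rightarrow> ('m \<Rightarrow> 's) \<Rightarrow> ('i \<Rightarrow> 'm \<Rightarrow> 'a) \<Rightarrow> 'j \<Rightarrow> 'i \<Rightarrow> 'b \<Rightarrow> real"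
  where "mean_curvature M S h \<psi> N j i x =
    - (1 / real DIM('b)) * endo_trace (shape_operator M S h \<psi> N j i x)"

definition maximal ::
    "('j, 'm, 'b::euclidean_space) manifold \<Rightarrow> ('i, 's, 'a::euclidean_space) manifold
      \<Rightarrow> ('i, 'a) tensor2 \<Rightarrow> ('m \<Rightarrow> 's) \<Rightarrow> ('i \<Rightarrow> 'm \<Rightarrow> 'a) \<Rightarrow> bool"
  where "maximal M S h \<psi> N \<longleftrightarrow>
    (\<forall>j\<in>charts M. \<forall>i\<in>charts S. \<forall>x\<in>local_dom M S \<psi> j i. mean_curvature M S h \<psi> N j i x = 0)"

text \<open>For \<open>S = interval_product I F\<close> and \<open>h = grw_metric f gF\<close>: the time-orientation of \<open>N\<close> and the
  hyperbolic angle.\<close>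

definition future_directed ::
    "('j, 'm, 'b) manifold \<Rightarrow> ('i, 's, real \<times> 'a::zero) manifold
      \<Rightarrow> ('i, real \<times> 'a) tensor2 \<Rightarrow> ('m \<Rightarrow> 's) \<Rightarrow> ('i \<Rightarrow> 'm \<Rightarrow> real \<times> 'a) \<Rightarrow> bool"
  where "future_directed M S h \<psi> N \<longleftrightarrow>
    (\<forall>p\<in>topspace (pts M). \<forall>i\<in>charts S. \<psi> p \<in> chart_dom S i \<longrightarrow>
       h i (coord S i (\<psi> p)) (N i p) grw_dt < 0)"

definition hyperbolic_angle ::
    "('j, 'm, 'b) manifold \<Rightarrow> ('i, 's, real \<times> 'a::zero) manifold
      \<Rightarrow> ('i, real \<times> 'a) tensor2 \<Rightarrow> ('m \<Rightarrow> 's) \<Rightarrow> ('i \<Rightarrow> 'm \<Rightarrow> real \<times> 'a) \<Rightarrow> ('m \<Rightarrow> real) \<Rightarrow> bool"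
  where "hyperbolic_angle M S h \<psi> N \<phi> \<longleftrightarrow>
    (\<forall>p\<in>topspace (pts M). \<phi> p \<ge> 0 \<and>
       (\<forall>i\<in>charts S. \<psi> p \<in> chart_dom S i \<longrightarrow>
          cosh (\<phi> p) = - h i (coord S i (\<psi> p)) (N i p) grw_dt))"

end

theory Submission
  imports Defs
begin

text \<open>Since \<open>M\<close> is spacelike, the fiber component \<open>\<pi>\<close> of the immersion is a local diffeomorphism, so
  in a chart everything can be expressed through the pulled back fiber metric \<open>\<gamma>\<close> and its connection
  \<open>\<Gamma>\<close>: the induced metric is \<open>f(\<tau>)\<^sup>2 \<gamma> - d\<tau> \<otimes> d\<tau>\<close> and the normal is \<open>N = (a, d\<pi> V)\<close> with
  \<open>a = cosh \<phi>\<close> and \<open>a V = \<nabla>\<tau>\<close>.  As \<open>\<gamma>\<close> is Ricci-flat, the Bochner type identity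
  \<open>div (\<nabla>\<^sub>V V) = V (div V) + tr ((\<nabla>V)\<^sup>2)\<close> holds for \<open>\<gamma>\<close>, while \<open>tr A = 0\<close> determines \<open>div V\<close>.
  With \<open>s = sinh\<^sup>2 \<phi>\<close> and \<open>\<rho> = f'/f\<close> this yields
  \<open>\<Delta>s / 2 = (1 + s) (tr A\<^sup>2 + \<rho>\<^sup>2 (n + 3 s) - n \<rho>' s) + 4 a \<rho> g(A\<nabla>\<tau>, \<nabla>\<tau>) + |A\<nabla>\<tau>|\<^sup>2\<close>.
  Null convergence means \<open>\<rho>' \<le> 0\<close>, and the mixed term is absorbed by Cauchy-Schwarz, since
  \<open>|\<nabla>\<tau>|\<^sup>2 = s\<close>.\<close>

section \<open>Second derivatives\<close>

text \<open>The map \<pi> is never inverted: all objects live on the chart of M, and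
  \<open>V\<close> and \<open>\<Gamma>\<close> are defined point by point through the inverse of the
  linear map d\<pi>. Their regularity therefore has to be won from Cramer's rule, and only what is
  won in this way (\<open>V\<close> twice differentiable, \<open>\<Gamma>\<close> once) enters the
  later arguments. This is why the symmetry of second derivatives is proved without continuity of
  those derivatives. No derivative of the shape operator and no Codazzi equation occur. The gradient
  of sinh^2 \<phi> is an explicit combination of \<nabla>_V V and V, so its divergence follows from
  the Bochner identity and from the difference between the connection of the induced metric and
  \<open>\<Gamma>\<close>. The curvature of the fiber enters through a single trace. The estimate
  closes because the Rayleigh quotient of A in the direction \<nabla>\<tau> bounds both tr A^2 and
  |A\<nabla>\<tau>|^2 from below, and together these bounds compensate the mixed term.\<close>

lemma dd_has_derivative: "f differentiable (at x) \<Longrightarrow> (f has_derivative dd f x) (at x)"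
  using frechet_derivative_works by blast

lemma dd_eqI: "(f has_derivative f') (at x) \<Longrightarrow> dd f x u = f' u"
  by (metis frechet_derivative_at)

lemma dd_cong_open:
  assumes "f differentiable (at x)" "open U" "x \<in> U" "\<And>y. y \<in> U \<Longrightarrow> f y = g y"
  shows "dd f x = dd g x"
  using frechet_derivative_transform_within_open[OF assms] .

lemma smooth_on_differentiable: "smooth_on S f \<Longrightarrow> x \<in> S \<Longrightarrow> f differentiable (at x)"
  unfolding smooth_on_def by (metis Ck_on.simps(2))

lemma smooth_on_dd: "smooth_on S f \<Longrightarrow> smooth_on S (\<lambda>x. dd f x u)"
  unfolding smooth_on_def by (metis Ck_on.simps(2))

lemma linear_dd: "f differentiable (at x) \<Longrightarrow> linear (dd f x)"
  by (simp add: linear_frechet_derivative)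

lemma differentiable_transform_open:
  assumes "f differentiable (at x)" "open U" "x \<in> U" "\<And>y. y \<in> U \<Longrightarrow> f y = g y"
  shows "g differentiable (at x)"
  using assms has_derivative_transform_within_open unfolding differentiable_def by metis

text \<open>The mean value theorem for \<open>s \<mapsto> f (x + s u + h v) - f (x + s u)\<close>
  turns the second difference into h times a difference of first derivatives in direction u. The
  linear approximation of these at the single point x then gives the estimate.\<close>

lemma second_difference_estimate:
  fixes f :: "'a::real_normed_vector \<Rightarrow> real"
  assumes S: "open S" "x \<in> S" and f: "\<And>y. y \<in> S \<Longrightarrow> f differentiable (at y)"
    and f2: "(\<lambda>y. dd f y u) differentiable (at x)" and e: "e > 0"
  shows "\<exists>d>0. \<forall>h. 0 < h \<and> h < d \<longrightarrow>
    \<bar>f (x + h *\<^sub>R u + h *\<^sub>R v) - f (x + h *\<^sub>R u) - f (x + h *\<^sub>R v) + f x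
      - h^2 * dd (\<lambda>y. dd f y u) x v\<bar> \<le> e * h^2"
proof -
  define D where "D = dd (\<lambda>y. dd f y u) x"
  define B where "B = norm u + norm v + 1"
  have B: "B > 0" unfolding B_def by (smt (verit) norm_ge_zero)
  have D: "((\<lambda>y. dd f y u) has_derivative D) (at x)"
    unfolding D_def using f2 by (rule dd_has_derivative)
  have linD: "linear D" using D has_derivative_linear by blast
  \<comment> \<open>The linear approximation is used at two points within distance
    \<open>h * B\<close> of x, so the two errors add up to \<open>e * h\<close>.\<close>
  have e2: "e / (2 * B) > 0" using e B by simp
  from D[unfolded has_derivative_at_alt] e2 obtain d1 where d1: "d1 > 0"
    "\<And>y. norm (y - x) < d1 \<Longrightarrow> norm (dd f y u - dd f x u - D (y - x)) \<le> e / (2 * B) * norm (y - x)"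
    by blast
  from S obtain d2 where d2: "d2 > 0" "\<And>y. norm (y - x) < d2 \<Longrightarrow> y \<in> S"
    unfolding open_dist by (auto simp: dist_norm)
  define d where "d = min d1 d2 / B"
  have "d > 0" using d1 d2 B by (simp add: d_def)
  moreover have "\<bar>f (x + h *\<^sub>R u + h *\<^sub>R v) - f (x + h *\<^sub>R u) - f (x + h *\<^sub>R v) + f x
      - h^2 * D v\<bar> \<le> e * h^2" if h: "0 < h" "h < d" for h
  proof -
    have hB: "h * B < min d1 d2" using h B by (simp add: d_def field_simps)
    have near: "norm (s *\<^sub>R u + t *\<^sub>R v) \<le> h * B" if "0 \<le> s" "s \<le> h" "0 \<le> t" "t \<le> h" for s t
    proof -
      have "norm (s *\<^sub>R u + t *\<^sub>R v) \<le> s * norm u + t * norm v"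
        using norm_triangle_ineq[of "s *\<^sub>R u" "t *\<^sub>R v"] that by simp
      also have "\<dots> \<le> h * norm u + h * norm v"
        using that by (intro add_mono mult_right_mono) auto
      also have "\<dots> \<le> h * B" using h by (simp add: B_def algebra_simps)
      finally show ?thesis .
    qed
    define g where "g s = f (x + s *\<^sub>R u + h *\<^sub>R v) - f (x + s *\<^sub>R u)" for s
    define g' where "g' s = dd f (x + s *\<^sub>R u + h *\<^sub>R v) u - dd f (x + s *\<^sub>R u) u" for s
    have dg: "(g has_real_derivative g' s) (at s)" if s: "0 \<le> s" "s \<le> h" for s
    proof -
      have i1: "x + s *\<^sub>R u + h *\<^sub>R v \<in> S"
        by (rule d2(2)) (use near[of s h] s h hB in \<open>simp add: algebra_simps\<close>)
      have i2: "x + s *\<^sub>R u \<in> S"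
        by (rule d2(2)) (use near[of s 0] s h hB in simp)
      have "((\<lambda>s. f (x + s *\<^sub>R u + h *\<^sub>R v)) has_derivative (\<lambda>r. dd f (x + s *\<^sub>R u + h *\<^sub>R v) (r *\<^sub>R u))) (at s)"
        by (rule has_derivative_compose[where f = "\<lambda>s. x + s *\<^sub>R u + h *\<^sub>R v" and g = f, OF _ dd_has_derivative[OF f[OF i1]]])
           (auto intro!: derivative_eq_intros)
      moreover have "((\<lambda>s. f (x + s *\<^sub>R u)) has_derivative (\<lambda>r. dd f (x + s *\<^sub>R u) (r *\<^sub>R u))) (at s)"
        by (rule has_derivative_compose[where f = "\<lambda>s. x + s *\<^sub>R u" and g = f, OF _ dd_has_derivative[OF f[OF i2]]])
           (auto intro!: derivative_eq_intros)
      ultimately have "(g has_derivative (\<lambda>r. dd f (x + s *\<^sub>R u + h *\<^sub>R v) (r *\<^sub>R u) - dd f (x + s *\<^sub>R u) (r *\<^sub>R u))) (at s)"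
        unfolding g_def by (rule has_derivative_diff)
      then show ?thesis
        unfolding has_field_derivative_def g'_def
        by (rule has_derivative_eq_rhs)
           (auto simp: fun_eq_iff linear_cmul[OF linear_dd[OF f[OF i1]]] linear_cmul[OF linear_dd[OF f[OF i2]]] right_diff_distrib mult.commute)
    qed
    obtain s where s: "0 < s" "s < h" "g h - g 0 = h * g' s"
      using MVT2[of 0 h g g'] h(1) dg by auto
    have n1: "norm (s *\<^sub>R u + h *\<^sub>R v) \<le> h * B" "norm (s *\<^sub>R u + 0 *\<^sub>R v) \<le> h * B"
      using near[of s h] near[of s 0] s h by auto
    have a1: "norm (dd f (x + (s *\<^sub>R u + h *\<^sub>R v)) u - dd f x u - D (s *\<^sub>R u + h *\<^sub>R v)) \<le> e / (2 * B) * (h * B)"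
      using d1(2)[of "x + (s *\<^sub>R u + h *\<^sub>R v)"] n1(1) hB e2
      by (smt (verit) add_diff_cancel_left' mult_left_mono)
    have a2: "norm (dd f (x + s *\<^sub>R u) u - dd f x u - D (s *\<^sub>R u)) \<le> e / (2 * B) * (h * B)"
      using d1(2)[of "x + s *\<^sub>R u"] n1(2) hB e2
      by (smt (verit) add_diff_cancel_left' mult_left_mono scaleR_zero_left add.right_neutral)
    have "D (s *\<^sub>R u + h *\<^sub>R v) = D (s *\<^sub>R u) + h * D v"
      by (simp add: linear_add[OF linD] linear_cmul[OF linD])
    then have "\<bar>g' s - h * D v\<bar> \<le> e / (2 * B) * (h * B) + e / (2 * B) * (h * B)"
      using a1 a2 by (simp add: g'_def add.assoc)
    also have "\<dots> = e * h" using B by (simp add: field_simps)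
    finally have "h * \<bar>g' s - h * D v\<bar> \<le> h * (e * h)" using h by (intro mult_left_mono) auto
    then have "\<bar>h * (g' s - h * D v)\<bar> \<le> e * h^2"
      using h by (simp add: abs_mult power2_eq_square mult_ac)
    moreover have "f (x + h *\<^sub>R u + h *\<^sub>R v) - f (x + h *\<^sub>R u) - f (x + h *\<^sub>R v) + f x - h^2 * D v = h * (g' s - h * D v)"
      using s(3) by (simp add: g_def algebra_simps power2_eq_square)
    ultimately show ?thesis by simp
  qed
  ultimately show ?thesis unfolding D_def by blast
qed

text \<open>The second difference is symmetric in u and v, so \<open>h^2\<close> times either mixed
  derivative approximates the same number.\<close>

lemma dd_commute_real:
  fixes f :: "'a::real_normed_vector \<Rightarrow> real"
  assumes S: "open S" "x \<in> S" and f: "\<And>y. y \<in> S \<Longrightarrow> f differentiable (at y)"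
    and f2: "\<And>u. (\<lambda>y. dd f y u) differentiable (at x)"
  shows "dd (\<lambda>y. dd f y u) x v = dd (\<lambda>y. dd f y v) x u"
proof (rule ccontr)
  let ?p = "dd (\<lambda>y. dd f y u) x v" and ?q = "dd (\<lambda>y. dd f y v) x u"
  assume "?p \<noteq> ?q"
  \<comment> \<open>With a quarter of the gap, the two errors together cover at most half of
    it.\<close>
  define e where "e = \<bar>?p - ?q\<bar> / 4"
  have e: "e > 0" using \<open>?p \<noteq> ?q\<close> by (simp add: e_def)
  obtain d1 where d1: "d1 > 0" "\<forall>h. 0 < h \<and> h < d1 \<longrightarrow>
    \<bar>f (x + h *\<^sub>R u + h *\<^sub>R v) - f (x + h *\<^sub>R u) - f (x + h *\<^sub>R v) + f x - h^2 * ?p\<bar> \<le> e * h^2"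
    using second_difference_estimate[OF S f f2 e] by blast
  obtain d2 where d2: "d2 > 0" "\<forall>h. 0 < h \<and> h < d2 \<longrightarrow>
    \<bar>f (x + h *\<^sub>R v + h *\<^sub>R u) - f (x + h *\<^sub>R v) - f (x + h *\<^sub>R u) + f x - h^2 * ?q\<bar> \<le> e * h^2"
    using second_difference_estimate[OF S f f2 e] by blast
  define h where "h = min d1 d2 / 2"
  have h: "0 < h" "h < d1" "h < d2" using d1 d2 by (auto simp: h_def)
  have "\<bar>f (x + h *\<^sub>R u + h *\<^sub>R v) - f (x + h *\<^sub>R u) - f (x + h *\<^sub>R v) + f x - h^2 * ?p\<bar> \<le> e * h^2"
    using d1 h by blast
  moreover have "\<bar>f (x + h *\<^sub>R u + h *\<^sub>R v) - f (x + h *\<^sub>R u) - f (x + h *\<^sub>R v) + f x - h^2 * ?q\<bar> \<le> e * h^2"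
    using d2(2)[rule_format, of h] h by (simp add: add.assoc add.commute[of "h *\<^sub>R v"] algebra_simps)
  ultimately have "\<bar>h^2 * ?p - h^2 * ?q\<bar> \<le> 2 * (e * h^2)" by linarith
  then have "h^2 * \<bar>?p - ?q\<bar> \<le> h^2 * (2 * e)"
    by (simp add: abs_mult mult_ac flip: right_diff_distrib)
  then have "\<bar>?p - ?q\<bar> \<le> 2 * e" using h by simp
  then show False using e by (simp add: e_def)
qed

lemma dd_inner:
  fixes f :: "'a::real_normed_vector \<Rightarrow> 'b::real_inner"
  assumes "f differentiable (at x)"
  shows "dd (\<lambda>y. f y \<bullet> b) x u = dd f x u \<bullet> b"
  by (rule dd_eqI) (auto intro!: derivative_eq_intros dd_has_derivative[OF assms])

lemma dd_commute:
  fixes f :: "'a::real_normed_vector \<Rightarrow> 'b::real_inner"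
  assumes S: "open S" "x \<in> S" and f: "\<And>y. y \<in> S \<Longrightarrow> f differentiable (at y)"
    and f2: "\<And>u. (\<lambda>y. dd f y u) differentiable (at x)"
  shows "dd (\<lambda>y. dd f y u) x v = dd (\<lambda>y. dd f y v) x u"
proof -
  have "dd (\<lambda>y. dd f y u) x v \<bullet> b = dd (\<lambda>y. dd f y v) x u \<bullet> b" for b
  proof -
    have d1: "(\<lambda>y. f y \<bullet> b) differentiable (at y)" if "y \<in> S" for y
      using f[OF that] by simp
    have eq: "dd f y w \<bullet> b = dd (\<lambda>y. f y \<bullet> b) y w" if "y \<in> S" for y w
      using dd_inner[OF f[OF that]] by simp
    have d2: "(\<lambda>y. dd (\<lambda>y. f y \<bullet> b) y w) differentiable (at x)" for w
      by (rule differentiable_transform_open[OF _ S, of "\<lambda>y. dd f y w \<bullet> b"]) (auto simp: f2 eq)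
    have "dd (\<lambda>y. dd f y w \<bullet> b) x = dd (\<lambda>y. dd (\<lambda>y. f y \<bullet> b) y w) x" for w
      by (rule dd_cong_open[OF _ S]) (auto simp: f2 eq)
    then show ?thesis
      using dd_commute_real[OF S d1 d2, of u v] by (metis dd_inner[OF f2])
  qed
  then show ?thesis by (metis inner_commute vector_eq_rdot)
qed

lemma linear_expand:
  fixes L :: "'a::euclidean_space \<Rightarrow> 'b::real_vector"
  assumes "linear L"
  shows "L u = (\<Sum>b\<in>Basis. (u \<bullet> b) *\<^sub>R L b)"
proof -
  have "L u = L (\<Sum>b\<in>Basis. (u \<bullet> b) *\<^sub>R b)" by (simp add: euclidean_representation)
  then show ?thesis by (simp add: linear_sum[OF assms] linear_cmul[OF assms])
qed

section \<open>Traces and families of linear maps\<close>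

lemma bilinear_expand:
  fixes \<beta> :: "'a::euclidean_space \<Rightarrow> 'b::euclidean_space \<Rightarrow> 'c::real_vector"
  assumes "bilinear \<beta>"
  shows "\<beta> u v = (\<Sum>b\<in>Basis. \<Sum>c\<in>Basis. ((u \<bullet> b) * (v \<bullet> c)) *\<^sub>R \<beta> b c)"
proof -
  have "\<beta> u v = (\<Sum>b\<in>Basis. (u \<bullet> b) *\<^sub>R \<beta> b v)"
    by (rule linear_expand) (use assms in \<open>simp add: bilinear_def\<close>)
  also have "\<dots> = (\<Sum>b\<in>Basis. (u \<bullet> b) *\<^sub>R (\<Sum>c\<in>Basis. (v \<bullet> c) *\<^sub>R \<beta> b c))"
    by (intro sum.cong arg_cong[where f = "scaleR _"] linear_expand refl) (use assms in \<open>simp add: bilinear_def\<close>)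
  finally show ?thesis by (simp add: scaleR_sum_right)
qed

text \<open>A product rule in which the base point and both arguments move. Differentiability in the
  base point is known only for fixed arguments; the expansion in a basis reduces the general case to
  finite sums of products.\<close>

lemma has_derivative_bilinear_family:
  fixes \<beta> :: "'w::real_normed_vector \<Rightarrow> 'a::euclidean_space \<Rightarrow> 'b::euclidean_space \<Rightarrow> 'c::real_normed_vector"
  assumes W: "open W" "p x \<in> W" and bil: "\<And>y. y \<in> W \<Longrightarrow> bilinear (\<beta> y)"
    and \<beta>: "\<And>u v. (\<lambda>y. \<beta> y u v) differentiable (at (p x))"
    and p: "(p has_derivative p') (at x)" and \<alpha>: "(\<alpha> has_derivative \<alpha>') (at x)"
    and \<delta>: "(\<delta> has_derivative \<delta>') (at x)"
  shows "((\<lambda>y. \<beta> (p y) (\<alpha> y) (\<delta> y)) has_derivative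
    (\<lambda>z. dd (\<lambda>y. \<beta> y (\<alpha> x) (\<delta> x)) (p x) (p' z) + \<beta> (p x) (\<alpha>' z) (\<delta> x) + \<beta> (p x) (\<alpha> x) (\<delta>' z))) (at x)"
proof -
  let ?b = "\<lambda>y u v. \<Sum>b\<in>Basis. \<Sum>c\<in>Basis. ((u \<bullet> b) * (v \<bullet> c)) *\<^sub>R \<beta> y b c"
  have p\<beta>: "((\<lambda>y. \<beta> (p y) b c) has_derivative (\<lambda>z. dd (\<lambda>y. \<beta> y b c) (p x) (p' z))) (at x)" for b c
    by (rule has_derivative_compose[where g = "\<lambda>y. \<beta> y b c", OF p dd_has_derivative[OF \<beta>]])
  have D: "((\<lambda>y. ?b (p y) (\<alpha> y) (\<delta> y)) has_derivative
    (\<lambda>z. \<Sum>b\<in>Basis. \<Sum>c\<in>Basis. ((\<alpha> x \<bullet> b) * (\<delta> x \<bullet> c)) *\<^sub>R dd (\<lambda>y. \<beta> y b c) (p x) (p' z)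
       + ((\<alpha>' z \<bullet> b) * (\<delta> x \<bullet> c)) *\<^sub>R \<beta> (p x) b c + ((\<alpha> x \<bullet> b) * (\<delta>' z \<bullet> c)) *\<^sub>R \<beta> (p x) b c)) (at x)"
    by (rule derivative_eq_intros p\<beta> \<alpha> \<delta> refl | simp add: algebra_simps)+
  have D2: "((\<lambda>y. ?b y (\<alpha> x) (\<delta> x)) has_derivative
      (\<lambda>z. \<Sum>b\<in>Basis. \<Sum>c\<in>Basis. ((\<alpha> x \<bullet> b) * (\<delta> x \<bullet> c)) *\<^sub>R dd (\<lambda>y. \<beta> y b c) (p x) z)) (at (p x))"
    by (rule derivative_eq_intros dd_has_derivative[OF \<beta>] refl | simp)+
  have "dd (\<lambda>y. \<beta> y (\<alpha> x) (\<delta> x)) (p x) z = dd (\<lambda>y. ?b y (\<alpha> x) (\<delta> x)) (p x) z" for z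
    by (rule fun_cong[where x = z], rule dd_cong_open[OF \<beta> W]) (rule bilinear_expand[OF bil])
  then have e: "dd (\<lambda>y. \<beta> y (\<alpha> x) (\<delta> x)) (p x) z =
      (\<Sum>b\<in>Basis. \<Sum>c\<in>Basis. ((\<alpha> x \<bullet> b) * (\<delta> x \<bullet> c)) *\<^sub>R dd (\<lambda>y. \<beta> y b c) (p x) z)" for z
    by (simp add: dd_eqI[OF D2])
  have e1: "\<beta> (p x) (\<alpha>' z) (\<delta> x) = ?b (p x) (\<alpha>' z) (\<delta> x)"
    and e2: "\<beta> (p x) (\<alpha> x) (\<delta>' z) = ?b (p x) (\<alpha> x) (\<delta>' z)" for z
    by (rule bilinear_expand[OF bil[OF W(2)]])+
  have "((\<lambda>y. ?b (p y) (\<alpha> y) (\<delta> y)) has_derivative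
     (\<lambda>z. dd (\<lambda>y. \<beta> y (\<alpha> x) (\<delta> x)) (p x) (p' z) + \<beta> (p x) (\<alpha>' z) (\<delta> x) + \<beta> (p x) (\<alpha> x) (\<delta>' z))) (at x)"
    by (rule has_derivative_eq_rhs[OF D])
       (simp add: fun_eq_iff e e1 e2 sum.distrib)
  \<comment> \<open>Bilinearity holds only over W, so the expansion is valid only where
    \<open>p y\<close> lies in W; continuity of p at x provides a neighbourhood.\<close>
  moreover have "\<forall>\<^sub>F y in at x. ?b (p y) (\<alpha> y) (\<delta> y) = \<beta> (p y) (\<alpha> y) (\<delta> y)"
  proof -
    have "(p \<longlongrightarrow> p x) (at x)"
      using p has_derivative_continuous continuous_at isCont_def by blast
    then have "\<forall>\<^sub>F y in at x. p y \<in> W" using W topological_tendstoD by blast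
    then show ?thesis by eventually_elim (rule bilinear_expand[OF bil, symmetric])
  qed
  ultimately show ?thesis
    by (rule has_derivative_transform_eventually) (auto intro: bilinear_expand[OF bil[OF W(2)], symmetric])
qed

section \<open>Differentiable dependence of the solution of a linear system\<close>

lemma differentiable_det:
  fixes A :: "'w::real_normed_vector \<Rightarrow> real^'n^'n"
  assumes "\<And>i j. (\<lambda>y. A y $ i $ j) differentiable (at x)"
  shows "(\<lambda>y. det (A y)) differentiable (at x)"
proof -
  have "(\<lambda>y. A y $ i $ j) differentiable (at x)" for i j using assms .
  then have "((\<lambda>y. A y $ i $ j) has_derivative dd (\<lambda>y. A y $ i $ j) x) (at x)" for i j
    by (rule dd_has_derivative)
  then have "(\<lambda>y. \<Prod>i\<in>UNIV. A y $ i $ q i) differentiable (at x)" for q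
    using has_derivative_prod[of UNIV "\<lambda>i y. A y $ i $ q i" "\<lambda>i. dd (\<lambda>y. A y $ i $ q i) x" x UNIV]
    unfolding differentiable_def by blast
  then show ?thesis unfolding det_def
    by (intro differentiable_sum differentiable_mult differentiable_const) (auto simp: finite_permutations)
qed

text \<open>By Cramer's rule the components of w are quotients of determinants with differentiable
  entries, so no regularity of w has to be known beforehand. Christoffel symbols, \<open>V\<close>
  and \<open>\<Gamma>\<close> are all obtained as such solutions.\<close>

lemma differentiable_linear_system:
  fixes L :: "'w::euclidean_space \<Rightarrow> real^'n \<Rightarrow> real^'n"
  assumes U: "open U" "x \<in> U" and lin: "\<And>y. y \<in> U \<Longrightarrow> linear (L y)" and inj: "\<And>y. y \<in> U \<Longrightarrow> inj (L y)"
    and L: "\<And>u. (\<lambda>y. L y u) differentiable (at x)"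
    and m: "m differentiable (at x)" and eq: "\<And>y. y \<in> U \<Longrightarrow> L y (w y) = m y"
  shows "w differentiable (at x)"
proof -
  define A where "A y = matrix (L y)" for y
  have A: "A y *v v = L y v" if "y \<in> U" for y v
    using lin[OF that] by (simp add: A_def matrix_works)
  have dA: "det (A y) \<noteq> 0" if "y \<in> U" for y
    using det_nz_iff_inj[of "L y"] lin[OF that] inj[OF that] by (simp add: A_def)
  define C where "C y k = (\<chi> i j. if j = k then m y $ i else A y $ i $ j)" for y k
  have comp: "(\<lambda>y. f y $ i) differentiable (at x)" if "f differentiable (at x)" for f :: "'w \<Rightarrow> real^'n" and i
    using that differentiable_compose[of "\<lambda>v. v $ i" f x UNIV]
    by (simp add: bounded_linear_imp_differentiable bounded_linear_vec_nth)
  have dAi: "(\<lambda>y. A y $ i $ j) differentiable (at x)" for i j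
    unfolding A_def matrix_def by (simp add: comp L)
  have dCi: "(\<lambda>y. C y k $ i $ j) differentiable (at x)" for i j k
    unfolding C_def by (cases "j = k") (simp_all add: comp m dAi)
  have "(\<lambda>y. (\<chi> k. det (C y k) / det (A y))) differentiable (at x)"
    
    by (subst differentiable_componentwise_within) (auto simp: Basis_vec_def inner_axis intro!: differentiable_divide differentiable_det dAi dCi dA U)
  moreover have "(\<chi> k. det (C y k) / det (A y)) = w y" if "y \<in> U" for y
    using cramer[OF dA[OF that], of "w y" "m y"] A[OF that] eq[OF that] by (simp add: C_def)
  ultimately show ?thesis using differentiable_transform_open[OF _ U] by blast
qed

section \<open>Algebra of traces and self-adjoint operators\<close>

lemma endo_trace_add: "endo_trace (\<lambda>u. F u + G u) = endo_trace F + endo_trace G"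
  by (simp add: endo_trace_def inner_add_left sum.distrib)

lemma endo_trace_diff: "endo_trace (\<lambda>u. F u - G u) = endo_trace F - endo_trace G"
  by (simp add: endo_trace_def inner_diff_left sum_subtractf)

lemma endo_trace_minus: "endo_trace (\<lambda>u. - F u) = - endo_trace F"
  by (simp add: endo_trace_def sum_negf)

lemma endo_trace_scaleR: "endo_trace (\<lambda>u. c *\<^sub>R F u) = c * endo_trace F"
  by (simp add: endo_trace_def sum_distrib_left)

lemma endo_trace_sum: "endo_trace (\<lambda>u. \<Sum>k\<in>K. F k u) = (\<Sum>k\<in>K. endo_trace (F k))"
  unfolding endo_trace_def inner_sum_left by (rule sum.swap)

lemma endo_trace_id: "endo_trace (\<lambda>u::'a::euclidean_space. u) = real DIM('a)"
  by (simp add: endo_trace_def)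

lemma endo_trace_rank_one:
  fixes l :: "'a::euclidean_space \<Rightarrow> real"
  assumes "linear l"
  shows "endo_trace (\<lambda>u. l u *\<^sub>R v) = l v"
  using linear_expand[OF assms, of v] by (simp add: endo_trace_def mult.commute)

text \<open>It serves twice: the commutator left over in the Bochner identity has no trace, and the
  Ricci trace is invariant under conjugation by d\<pi>.\<close>

lemma endo_trace_compose_commute:
  fixes F :: "'a::euclidean_space \<Rightarrow> 'b::euclidean_space" and G :: "'b \<Rightarrow> 'a"
  assumes F: "linear F" and G: "linear G"
  shows "endo_trace (\<lambda>u. F (G u)) = endo_trace (\<lambda>u. G (F u))"
proof -
  have "endo_trace (\<lambda>u. F (G u)) = (\<Sum>b\<in>Basis. \<Sum>c\<in>Basis. (G b \<bullet> c) * (F c \<bullet> b))"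
    unfolding endo_trace_def by (subst linear_expand[OF F]) (simp add: inner_sum_left)
  also have "\<dots> = (\<Sum>c\<in>Basis. \<Sum>b\<in>Basis. (F c \<bullet> b) * (G b \<bullet> c))"
    by (subst sum.swap) (simp add: mult.commute)
  also have "\<dots> = endo_trace (\<lambda>u. G (F u))"
    unfolding endo_trace_def by (subst (2) linear_expand[OF G]) (simp add: inner_sum_left)
  finally show ?thesis .
qed

lemma endo_trace_prod:
  fixes L :: "real \<times> 'a::euclidean_space \<Rightarrow> real \<times> 'a"
  shows "endo_trace L = fst (L (1, 0)) + endo_trace (\<lambda>u. snd (L (0, u)))"
proof -
  have "endo_trace L = (\<Sum>b\<in>(\<lambda>u. (u, 0)) ` (Basis::real set). L b \<bullet> b) + (\<Sum>b\<in>Pair 0 ` (Basis::'a set). L b \<bullet> b)"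
    unfolding endo_trace_def Basis_prod_def
    by (rule sum.union_disjoint) auto
  then show ?thesis by (simp add: endo_trace_def sum.reindex inj_on_def inner_prod_def)
qed

text \<open>An orthonormal set is independent, since its coefficients are recovered by g, so one of
  greatest cardinality exists. If some u differed from its expansion, the normalised remainder could
  be added to the set.\<close>

lemma orthonormal_basis_exists:
  fixes g :: "'a::euclidean_space \<Rightarrow> 'a \<Rightarrow> real"
  assumes g: "bilinear g" and sym: "\<And>u v. g u v = g v u" and pos: "\<And>u. u \<noteq> 0 \<Longrightarrow> g u u > 0"
  obtains B where "finite B" "\<And>u. u = (\<Sum>e\<in>B. g u e *\<^sub>R e)" "\<And>e e'. e \<in> B \<Longrightarrow> e' \<in> B \<Longrightarrow> g e e' = of_bool (e = e')"
proof -
  have lin: "linear (g u)" "linear (\<lambda>u. g u v)" for u v using g by (auto simp: bilinear_def)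
  define ON where "ON B \<longleftrightarrow> finite B \<and> (\<forall>e\<in>B. \<forall>e'\<in>B. g e e' = of_bool (e = e'))" for B
  have coef: "g (\<Sum>e\<in>B. c e *\<^sub>R e) e' = c e'" if "ON B" "e' \<in> B" for B c e'
  proof -
    have "g (\<Sum>e\<in>B. c e *\<^sub>R e) e' = (\<Sum>e\<in>B. c e * g e e')"
      by (simp add: linear_sum[OF lin(2)] linear_cmul[OF lin(2)])
    also have "\<dots> = (\<Sum>e\<in>B. if e = e' then c e else 0)"
      by (rule sum.cong) (use that in \<open>auto simp: ON_def\<close>)
    finally show ?thesis using that by (simp add: ON_def)
  qed
  have card: "card B \<le> DIM('a)" if B: "ON B" for B
  proof -
    have "independent B"
    proof (rule independent_if_scalars_zero)
      fix c e assume "(\<Sum>x\<in>B. c x *\<^sub>R x) = 0" "e \<in> B"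
      then show "c e = 0" using coef[OF B, of e c] linear_0[OF lin(2)] by simp
    qed (use B in \<open>auto simp: ON_def\<close>)
    then show ?thesis using independent_bound by blast
  qed
  have "ON {}" by (simp add: ON_def)
  then obtain B where B: "ON B" and max: "\<And>C. ON C \<Longrightarrow> card C \<le> card B"
    using ex_has_greatest_nat[of ON "{}" card "Suc DIM('a)"] card by (metis less_Suc_eq_le)
  have "u = (\<Sum>e\<in>B. g u e *\<^sub>R e)" for u
  proof (rule ccontr)
    define w where "w = u - (\<Sum>e\<in>B. g u e *\<^sub>R e)"
    assume "u \<noteq> (\<Sum>e\<in>B. g u e *\<^sub>R e)"
    then have w: "g w w > 0" using pos by (simp add: w_def)
    have orth: "g w e = 0" if "e \<in> B" for e
      using coef[OF B that, of "g u"] by (simp add: w_def linear_diff[OF lin(2)])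
    define e0 where "e0 = (1 / sqrt (g w w)) *\<^sub>R w"
    have e0: "g e0 e0 = 1"
      using w by (simp add: e0_def linear_cmul[OF lin(1)] linear_cmul[OF lin(2)] field_simps real_sqrt_mult_self)
    have o: "g e0 e = 0" "g e e0 = 0" if "e \<in> B" for e
    proof -
      show "g e0 e = 0" using orth[OF that] by (simp add: e0_def linear_cmul[OF lin(2)])
      then show "g e e0 = 0" by (simp only: sym[of e e0])
    qed
    then have "e0 \<notin> B" using e0 by force
    moreover from this have "ON (insert e0 B)"
      using B e0 o by (auto simp: ON_def)
    ultimately show False using max[of "insert e0 B"] B by (simp add: ON_def)
  qed
  then show ?thesis using that B unfolding ON_def by blast
qed

text \<open>In an orthonormal basis the trace is the sum of \<open>g (C e) (C e)\<close>.\<close>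

lemma endo_trace_square_self_adjoint_nonneg:
  fixes g :: "'a::euclidean_space \<Rightarrow> 'a \<Rightarrow> real"
  assumes g: "bilinear g" and sym: "\<And>u v. g u v = g v u" and pos: "\<And>u. u \<noteq> 0 \<Longrightarrow> g u u > 0"
    and C: "linear C" and adj: "\<And>u v. g (C u) v = g u (C v)"
  shows "endo_trace (\<lambda>u. C (C u)) \<ge> 0"
proof -
  obtain B where B: "finite B" "\<And>u. u = (\<Sum>e\<in>B. g u e *\<^sub>R e)"
    using orthonormal_basis_exists[OF g sym pos] by metis
  have lin: "linear (\<lambda>u. g u v)" for v using g by (auto simp: bilinear_def)
  have "endo_trace (\<lambda>u. C (C u)) = endo_trace (\<lambda>u. \<Sum>e\<in>B. g u e *\<^sub>R C (C e))"
    by (subst (1) B(2)) (simp add: linear_sum[OF C] linear_cmul[OF C])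
  also have "\<dots> = (\<Sum>e\<in>B. g (C (C e)) e)"
    by (simp add: endo_trace_sum endo_trace_rank_one[OF lin])
  also have "\<dots> = (\<Sum>e\<in>B. g (C e) (C e))" by (simp add: adj)
  also have "\<dots> \<ge> 0"
    by (rule sum_nonneg) (metis pos order.refl less_imp_le lin linear_0)
  finally show ?thesis .
qed

text \<open>This is Cauchy-Schwarz for the form tr(XY) on self-adjoint operators, applied to A and
  the rank-one operator \<open>u \<mapsto> g u w *\<^sub>R w\<close>. The constant k is the
  coefficient of the projection of A to that operator, C is the remainder, and tr C^2 is
  nonnegative.\<close>

lemma endo_trace_square_self_adjoint_ge:
  fixes g :: "'a::euclidean_space \<Rightarrow> 'a \<Rightarrow> real"
  assumes g: "bilinear g" and sym: "\<And>u v. g u v = g v u" and pos: "\<And>u. u \<noteq> 0 \<Longrightarrow> g u u > 0"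
    and A: "linear A" and adj: "\<And>u v. g (A u) v = g u (A v)"
  shows "(g (A w) w)\<^sup>2 \<le> (g w w)\<^sup>2 * endo_trace (\<lambda>u. A (A u))"
proof (cases "w = 0")
  case True
  then show ?thesis using g A by (simp add: bilinear_lzero linear_0)
next
  case False
  define s where "s = g w w"
  define k where "k = g (A w) w / s\<^sup>2"
  have s: "s > 0" using pos[OF False] by (simp add: s_def)
  have lin: "linear (g u)" "linear (\<lambda>u. g u v)" for u v using g by (auto simp: bilinear_def)
  define C where "C u = A u - (k * g u w) *\<^sub>R w" for u
  have C: "linear C"
    unfolding C_def
    by (intro linear_compose_sub A) (auto intro!: linearI simp: linear_add[OF lin(2)] linear_cmul[OF lin(2)] algebra_simps)
  have adjC: "g (C u) v = g u (C v)" for u v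
    by (simp add: C_def linear_diff[OF lin(1)] linear_diff[OF lin(2)] linear_cmul[OF lin(1)] linear_cmul[OF lin(2)] adj sym[of w v])
  have lA: "linear (\<lambda>u. g (A u) w)" and lw: "linear (\<lambda>u. k * g u w)"
    using A lin(2) by (auto intro!: linearI simp: linear_add linear_cmul linear_add[OF lin(2)] linear_cmul[OF lin(2)] algebra_simps)
  have "C (C u) = A (A u) - (k * g u w) *\<^sub>R A w - (k * g (A u) w) *\<^sub>R w + (k * s * (k * g u w)) *\<^sub>R w" for u
    by (simp add: C_def linear_diff[OF A] linear_cmul[OF A] linear_diff[OF lin(2)] linear_cmul[OF lin(2)] s_def algebra_simps)
  moreover have "linear (\<lambda>u. k * g (A u) w)" "linear (\<lambda>u. k * s * (k * g u w))"
    using linear_compose_scale_right[OF lA, of k] linear_compose_scale_right[OF lw, of "k * s"] by simp_all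
  ultimately have "endo_trace (\<lambda>u. C (C u)) = endo_trace (\<lambda>u. A (A u)) - k * g (A w) w - k * g (A w) w + k * s * (k * s)"
    using lw by (simp add: endo_trace_add endo_trace_diff endo_trace_rank_one s_def)
  also have "\<dots> = endo_trace (\<lambda>u. A (A u)) - (g (A w) w)\<^sup>2 / s\<^sup>2"
    using s by (simp add: k_def field_simps power2_eq_square)
  finally have "(g (A w) w)\<^sup>2 / s\<^sup>2 \<le> endo_trace (\<lambda>u. A (A u))"
    using endo_trace_square_self_adjoint_nonneg[OF g sym pos C adjC] by simp
  then show ?thesis using s by (simp add: s_def field_simps)
qed

section \<open>Connections\<close>

text \<open>The bilinear rule with a scalar second argument held at 1.\<close>

lemma has_derivative_linear_family:
  fixes L :: "'w::real_normed_vector \<Rightarrow> 'a::euclidean_space \<Rightarrow> 'c::real_normed_vector"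
  assumes W: "open W" "p x \<in> W" and lin: "\<And>y. y \<in> W \<Longrightarrow> linear (L y)"
    and L: "\<And>u. (\<lambda>y. L y u) differentiable (at (p x))"
    and p: "(p has_derivative p') (at x)" and \<alpha>: "(\<alpha> has_derivative \<alpha>') (at x)"
  shows "((\<lambda>y. L (p y) (\<alpha> y)) has_derivative
    (\<lambda>z. dd (\<lambda>y. L y (\<alpha> x)) (p x) (p' z) + L (p x) (\<alpha>' z))) (at x)"
proof -
  have bil: "bilinear (\<lambda>u (v::real). v *\<^sub>R L y u)" if "y \<in> W" for y
    using lin[OF that]
    by (auto simp: bilinear_def linear_iff algebra_simps)
  show ?thesis
    using has_derivative_bilinear_family[where \<beta> = "\<lambda>y u v. v *\<^sub>R L y u" and \<delta> = "\<lambda>_. 1",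
        OF W bil _ p \<alpha> has_derivative_const] L by simp
qed

lemmas has_derivative_bilinear_family_id =
  has_derivative_bilinear_family[where p = "\<lambda>y. y", OF _ _ _ _ has_derivative_ident]

lemmas has_derivative_linear_family_id =
  has_derivative_linear_family[where p = "\<lambda>y. y", OF _ _ _ _ has_derivative_ident]

text \<open>\<open>B\<close> is \<nabla>V for the torsion-free connection \<Gamma>, and the last
  trace is that of \<open>u \<mapsto> R(u,V)V\<close>, that is Ric(V,V). The identity is the
  contracted commutation rule for \<nabla>\<nabla>V, a statement about connections alone: the second
  derivatives of V cancel because they are symmetric.\<close>

lemma divergence_of_self_derivative:
  fixes V :: "'a::euclidean_space \<Rightarrow> 'a" and \<Gamma> :: "'a \<Rightarrow> 'a \<Rightarrow> 'a \<Rightarrow> 'a"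
  assumes U: "open U" "x \<in> U"
    and bil: "\<And>y. y \<in> U \<Longrightarrow> bilinear (\<Gamma> y)" and sym: "\<And>y u v. y \<in> U \<Longrightarrow> \<Gamma> y u v = \<Gamma> y v u"
    and d\<Gamma>: "\<And>u v. (\<lambda>y. \<Gamma> y u v) differentiable (at x)"
    and dV: "\<And>y. y \<in> U \<Longrightarrow> V differentiable (at y)"
    and ddV: "\<And>u. (\<lambda>y. dd V y u) differentiable (at x)"
  defines "B \<equiv> \<lambda>y u. dd V y u + \<Gamma> y u (V y)"
  shows "(\<lambda>y. B y (V y)) differentiable (at x)"
    and "endo_trace (\<lambda>u. dd (\<lambda>y. B y (V y)) x u + \<Gamma> x u (B x (V x))) =
      dd (\<lambda>y. endo_trace (B y)) x (V x) + endo_trace (\<lambda>u. B x (B x u))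
      + endo_trace (\<lambda>u. dd (\<lambda>y. \<Gamma> y (V x) (V x)) x u - dd (\<lambda>y. \<Gamma> y u (V x)) x (V x)
          + \<Gamma> x u (\<Gamma> x (V x) (V x)) - \<Gamma> x (V x) (\<Gamma> x u (V x)))"
proof -
  note hV = dd_has_derivative[OF dV[OF U(2)]]
  have linV: "linear (dd V y)" if "y \<in> U" for y using linear_dd[OF dV[OF that]] .
  have bx: "bilinear (\<Gamma> x)" using bil U by blast
  note bs = bilinear_ladd[OF bx] bilinear_radd[OF bx]
  have 1: "((\<lambda>y. B y (V y)) has_derivative (\<lambda>u. (dd (\<lambda>y. dd V y (V x)) x u + dd V x (dd V x u))
      + (dd (\<lambda>y. \<Gamma> y (V x) (V x)) x u + \<Gamma> x (dd V x u) (V x) + \<Gamma> x (V x) (dd V x u)))) (at x)"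
    unfolding B_def
    by (intro has_derivative_add has_derivative_linear_family_id[OF U linV ddV hV]
        has_derivative_bilinear_family_id[OF U bil d\<Gamma> hV hV])
  then show "(\<lambda>y. B y (V y)) differentiable (at x)" unfolding differentiable_def by blast
  have 2: "((\<lambda>y. B y b) has_derivative (\<lambda>w. dd (\<lambda>y. dd V y b) x w
      + (dd (\<lambda>y. \<Gamma> y b (V x)) x w + \<Gamma> x 0 (V x) + \<Gamma> x b (dd V x w)))) (at x)" for b
    unfolding B_def
    by (intro has_derivative_add dd_has_derivative[OF ddV]
        has_derivative_bilinear_family_id[OF U bil d\<Gamma> has_derivative_const hV])
  have "((\<lambda>y. endo_trace (B y)) has_derivative (\<lambda>w. endo_trace (\<lambda>b. dd (\<lambda>y. dd V y b) x w
      + (dd (\<lambda>y. \<Gamma> y b (V x)) x w + \<Gamma> x 0 (V x) + \<Gamma> x b (dd V x w))))) (at x)"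
    unfolding endo_trace_def by (intro has_derivative_sum has_derivative_inner_left 2)
  then have t: "dd (\<lambda>y. endo_trace (B y)) x (V x) = endo_trace (\<lambda>b. dd (\<lambda>y. dd V y b) x (V x)
      + (dd (\<lambda>y. \<Gamma> y b (V x)) x (V x) + \<Gamma> x b (dd V x (V x))))"
    by (simp add: dd_eqI bilinear_lzero[OF bx])
  have lin\<Gamma>: "linear (\<lambda>u. \<Gamma> x u (V x))" using bx by (simp add: bilinear_def)
  have comm: "endo_trace (\<lambda>u. \<Gamma> x (dd V x u) (V x) - dd V x (\<Gamma> x u (V x))) = 0"
    unfolding endo_trace_diff using endo_trace_compose_commute[OF lin\<Gamma> linV[OF U(2)]] by simp
  have c: "dd (\<lambda>y. dd V y u) x (V x) = dd (\<lambda>y. dd V y (V x)) x u" for u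
    by (rule dd_commute[OF U dV ddV])
  show "endo_trace (\<lambda>u. dd (\<lambda>y. B y (V y)) x u + \<Gamma> x u (B x (V x))) =
      dd (\<lambda>y. endo_trace (B y)) x (V x) + endo_trace (\<lambda>u. B x (B x u))
      + endo_trace (\<lambda>u. dd (\<lambda>y. \<Gamma> y (V x) (V x)) x u - dd (\<lambda>y. \<Gamma> y u (V x)) x (V x)
          + \<Gamma> x u (\<Gamma> x (V x) (V x)) - \<Gamma> x (V x) (\<Gamma> x u (V x)))"
    (is "?lhs = ?rhs")
  proof -
    \<comment> \<open>The two sides differ by the trace of the commutator of \<open>\<Gamma> V\<close> and \<open>dV\<close>.\<close>
    have "?lhs = ?rhs + endo_trace (\<lambda>u. \<Gamma> x (dd V x u) (V x) - dd V x (\<Gamma> x u (V x)))"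
      unfolding t c dd_eqI[OF 1] endo_trace_add[symmetric]
      by (rule arg_cong[where f = endo_trace])
        (simp add: fun_eq_iff B_def bs linear_add[OF linV[OF U(2)]] sym[OF U(2), of "V x" "dd V x _"]
          sym[OF U(2), of "V x" "\<Gamma> x _ _"])
    then show ?thesis using comm by simp
  qed
qed

text \<open>With \<open>l = p / s\<close>, the Rayleigh quotient of the shape operator at
  \<nabla>\<tau>, the hypotheses become \<open>T \<ge> l^2\<close> and
  \<open>R \<ge> s * l^2\<close>. By the square of \<open>l + a * r\<close> the mixed term costs at
  most \<open>2 * s * l^2 + 2 * s * (1 + s) * r^2\<close>. The terms in \<open>l^2\<close> then add
  up to exactly \<open>l^2\<close>, and with n replaced by 2 the coefficient of \<open>r^2\<close>
  exceeds \<open>s^2\<close> by \<open>2 + 3 * s\<close>.\<close>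

lemma scalar_inequality:
  fixes s r T R p n a :: real
  assumes s: "s \<ge> 0" and a: "a^2 = 1 + s" and n: "n \<ge> 2" and p1: "p^2 \<le> s^2 * T" and p2: "p^2 \<le> s * R"
    and T: "T \<ge> 0" and R: "R \<ge> 0"
  shows "(1 + s) * (T + r^2 * (n + 3 * s)) + 4 * a * r * p + R \<ge> r^2 * s^2"
proof (cases "s = 0")
  case True
  then show ?thesis using p1 T R n by simp
next
  case False
  define l where "l = p / s"
  have l: "p = l * s" "s > 0" using False s by (auto simp: l_def)
  have T': "T \<ge> l^2" using p1 l by (simp add: power_mult_distrib mult.commute)
  have R': "R \<ge> s * l^2"
  proof -
    have "s * (s * l^2) \<le> s * R" using p2 l by (simp add: power2_eq_square mult_ac)
    then show ?thesis using l by simp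
  qed
  have "(l + a * r)^2 \<ge> 0" by simp
  then have "2 * a * r * l \<ge> - (l^2) - (1 + s) * r^2"
    unfolding a[symmetric] by (simp add: power2_eq_square algebra_simps)
  then have "2 * s * (2 * a * r * l) \<ge> 2 * s * (- (l^2) - (1 + s) * r^2)"
    using l by (intro mult_left_mono) auto
  then have 1: "4 * a * r * p \<ge> - (2 * s * l^2) - 2 * s * (1 + s) * r^2"
    using l by (simp add: algebra_simps)
  have 2: "(1 + s) * T \<ge> (1 + s) * l^2" using T' l by (intro mult_left_mono) auto
  have "(1 + s) * r^2 * n \<ge> (1 + s) * r^2 * 2" using n l by (intro mult_left_mono) auto
  then have "(1 + s) * (r^2 * (n + 3 * s)) \<ge> (1 + s) * (r^2 * (2 + 3 * s))"
    by (simp add: algebra_simps)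
  then have "(1 + s) * (T + r^2 * (n + 3 * s)) + 4 * a * r * p + R - r^2 * s^2
      \<ge> (1 + s) * l^2 + (1 + s) * (r^2 * (2 + 3 * s)) - 2 * s * l^2 - 2 * s * (1 + s) * r^2 + s * l^2 - r^2 * s^2"
    using 1 2 R' by (simp add: distrib_left)
  also have "(1 + s) * l^2 + (1 + s) * (r^2 * (2 + 3 * s)) - 2 * s * l^2 - 2 * s * (1 + s) * r^2 + s * l^2 - r^2 * s^2
      = l^2 + r^2 * (2 + 3 * s)"
    by (simp add: power2_eq_square algebra_simps)
  finally show ?thesis using l by (smt (verit) mult_nonneg_nonneg zero_le_power2)
qed

text \<open>Nondegeneracy gives the uniqueness behind \<open>THE\<close>, so the rule serves the
  Lorentzian warped metric as well as the Riemannian ones.\<close>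

lemma christoffel_eqI:
  assumes bil: "bilinear (h x)" and nondeg: "\<And>w. (\<And>z. h x w z = 0) \<Longrightarrow> w = 0"
    and eq: "\<And>z. h x w z = (dd (\<lambda>y. h y v z) x u + dd (\<lambda>y. h y u z) x v - dd (\<lambda>y. h y u v) x z) / 2"
  shows "christoffel h x u v = w"
  unfolding christoffel_def
proof (rule the_equality)
  fix w' assume "\<forall>z. h x w' z = (dd (\<lambda>y. h y v z) x u + dd (\<lambda>y. h y u z) x v - dd (\<lambda>y. h y u v) x z) / 2"
  then have "h x (w' - w) z = 0" for z by (simp add: bilinear_lsub[OF bil] eq)
  then show "w' = w" using nondeg[of "w' - w"] by simp
qed (simp add: eq)

lemma gradient_eqI:
  assumes bil: "bilinear (h x)" and nondeg: "\<And>w. (\<And>z. h x w z = 0) \<Longrightarrow> w = 0"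
    and eq: "\<And>z. h x w z = dd u x z"
  shows "gradient h u x = w"
  unfolding gradient_def
proof (rule the_equality)
  fix w' assume "\<forall>z. h x w' z = dd u x z"
  then have "h x (w' - w) z = 0" for z by (simp add: bilinear_lsub[OF bil] eq)
  then show "w' = w" using nondeg[of "w' - w"] by simp
qed (simp add: eq)

section \<open>Graphs over a fiber with a connection\<close>

text \<open>The hypersurface seen from its own chart, with f1 and f2 for f' and f''.
  \<open>unit\<close> and \<open>normal\<close> say that the vector (a, d\<pi> V) has square -1 and
  is orthogonal to the hypersurface. The connection is pinned down by its symmetry and by
  \<open>compat\<close> instead of being \<open>christoffel \<gamma>\<close>: as a pullback it comes
  with a formula from which its regularity and curvature can be read off.\<close>

locale warped_graph =
  fixes U :: "'a::euclidean_space set" and \<gamma> :: "'a \<Rightarrow> 'a \<Rightarrow> 'a \<Rightarrow> real" and \<Gamma> :: "'a \<Rightarrow> 'a \<Rightarrow> 'a \<Rightarrow> 'a"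
    and \<tau> a :: "'a \<Rightarrow> real" and V :: "'a \<Rightarrow> 'a" and f f1 f2 :: "real \<Rightarrow> real"
  assumes open_U: "open U"
    and \<gamma>_bil: "x \<in> U \<Longrightarrow> bilinear (\<gamma> x)" and \<gamma>_sym: "x \<in> U \<Longrightarrow> \<gamma> x u v = \<gamma> x v u"
    and \<gamma>_diff: "x \<in> U \<Longrightarrow> (\<lambda>y. \<gamma> y u v) differentiable (at x)"
    and \<Gamma>_bil: "x \<in> U \<Longrightarrow> bilinear (\<Gamma> x)" and \<Gamma>_sym: "x \<in> U \<Longrightarrow> \<Gamma> x u v = \<Gamma> x v u"
    and \<Gamma>_diff: "x \<in> U \<Longrightarrow> (\<lambda>y. \<Gamma> y u v) differentiable (at x)"
    and compat: "x \<in> U \<Longrightarrow> dd (\<lambda>y. \<gamma> y v w) x u = \<gamma> x (\<Gamma> x u v) w + \<gamma> x v (\<Gamma> x u w)"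
    and V_diff: "x \<in> U \<Longrightarrow> V differentiable (at x)"
    and dV_diff: "x \<in> U \<Longrightarrow> (\<lambda>y. dd V y u) differentiable (at x)"
    and \<tau>_diff: "x \<in> U \<Longrightarrow> \<tau> differentiable (at x)"
    and d\<tau>_diff: "x \<in> U \<Longrightarrow> (\<lambda>y. dd \<tau> y u) differentiable (at x)"
    and a_diff: "x \<in> U \<Longrightarrow> a differentiable (at x)" and a_pos: "x \<in> U \<Longrightarrow> a x > 0"
    and f_deriv: "x \<in> U \<Longrightarrow> (f has_real_derivative f1 (\<tau> x)) (at (\<tau> x))"
    and f1_deriv: "x \<in> U \<Longrightarrow> (f1 has_real_derivative f2 (\<tau> x)) (at (\<tau> x))"
    and f_pos: "x \<in> U \<Longrightarrow> f (\<tau> x) > 0"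
    and unit: "x \<in> U \<Longrightarrow> (f (\<tau> x))\<^sup>2 * \<gamma> x (V x) (V x) = (a x)\<^sup>2 - 1"
    and normal: "x \<in> U \<Longrightarrow> (f (\<tau> x))\<^sup>2 * \<gamma> x (V x) u = a x * dd \<tau> x u"
    and spacelike: "x \<in> U \<Longrightarrow> u \<noteq> 0 \<Longrightarrow> (f (\<tau> x))\<^sup>2 * \<gamma> x u u - (dd \<tau> x u)\<^sup>2 > 0"
begin

text \<open>\<open>g\<close> is the induced metric and \<open>A\<close> the shape operator.  The second fundamental form is written
  as \<open>\<kappa>\<close>, which is visibly symmetric; that it equals \<open>g (A u) v\<close> is lemma \<open>gA\<close> below.\<close>

definition "\<rho> x = f1 (\<tau> x) / f (\<tau> x)"
text \<open>The derivative of \<open>f1 / f\<close>, taken in the time variable and evaluated at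
  \<open>\<tau> x\<close>.\<close>

definition "\<rho>' x = f2 (\<tau> x) / f (\<tau> x) - (\<rho> x)\<^sup>2"
definition "B x u = dd V x u + \<Gamma> x u (V x)"
definition "A x u = - B x u - \<rho> x *\<^sub>R (dd \<tau> x u *\<^sub>R V x + a x *\<^sub>R u)"
definition "g x u v = (f (\<tau> x))\<^sup>2 * \<gamma> x u v - dd \<tau> x u * dd \<tau> x v"
definition "hess x u v = dd (\<lambda>y. dd \<tau> y v) x u - dd \<tau> x (\<Gamma> x u v)"
definition "\<kappa> x u v = - a x * (hess x u v + f (\<tau> x) * f1 (\<tau> x) * \<gamma> x u v - 2 * \<rho> x * dd \<tau> x u * dd \<tau> x v)"
text \<open>The gradient of a^2, and so of sinh^2 \<phi>, for g. From \<nabla>\<tau> = a V and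
  \<open>dd_a\<close> one gets -2 a^2 (A V + \<rho> a V); eliminating A V by \<open>B_V\<close>
  leaves this combination, to which the Bochner identity applies.\<close>

definition "grad_field y = (2 * (a y)\<^sup>2) *\<^sub>R B y (V y) + (2 * (\<rho> y * ((a y)\<^sup>2 - 1) * a y)) *\<^sub>R V y"

context
  fixes x assumes x: "x \<in> U"
begin

lemmas hV = dd_has_derivative[OF V_diff[OF x]]
lemmas h\<tau> = dd_has_derivative[OF \<tau>_diff[OF x]]
lemmas ha = dd_has_derivative[OF a_diff[OF x]]
lemmas linV = linear_dd[OF V_diff[OF x]]
lemmas lin\<tau> = linear_dd[OF \<tau>_diff[OF x]]
lemmas lina = linear_dd[OF a_diff[OF x]]
lemmas \<gamma>b = \<gamma>_bil[OF x]
lemmas \<Gamma>b = \<Gamma>_bil[OF x]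
lemmas lin_simps = linear_add[OF linV] linear_cmul[OF linV] linear_diff[OF linV] linear_neg[OF linV]
  linear_add[OF lin\<tau>] linear_cmul[OF lin\<tau>] linear_diff[OF lin\<tau>] linear_neg[OF lin\<tau>]
  linear_add[OF lina] linear_cmul[OF lina] linear_diff[OF lina] linear_neg[OF lina]
  bilinear_ladd[OF \<gamma>b] bilinear_radd[OF \<gamma>b] bilinear_lsub[OF \<gamma>b] bilinear_rsub[OF \<gamma>b]
  bilinear_lmul[OF \<gamma>b] bilinear_rmul[OF \<gamma>b] bilinear_lneg[OF \<gamma>b] bilinear_rneg[OF \<gamma>b]
  bilinear_ladd[OF \<Gamma>b] bilinear_radd[OF \<Gamma>b] bilinear_lsub[OF \<Gamma>b] bilinear_rsub[OF \<Gamma>b]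
  bilinear_lmul[OF \<Gamma>b] bilinear_rmul[OF \<Gamma>b] bilinear_lneg[OF \<Gamma>b] bilinear_rneg[OF \<Gamma>b]

section \<open>First-order identities for height, angle and shape operator\<close>

lemma has_derivative_\<gamma>:
  assumes "(\<alpha> has_derivative \<alpha>') (at x)" "(\<delta> has_derivative \<delta>') (at x)"
  shows "((\<lambda>y. \<gamma> y (\<alpha> y) (\<delta> y)) has_derivative (\<lambda>u. \<gamma> x (\<Gamma> x u (\<alpha> x)) (\<delta> x)
      + \<gamma> x (\<alpha> x) (\<Gamma> x u (\<delta> x)) + \<gamma> x (\<alpha>' u) (\<delta> x) + \<gamma> x (\<alpha> x) (\<delta>' u))) (at x)"
  using has_derivative_bilinear_family_id[OF open_U x \<gamma>_bil \<gamma>_diff[OF x] assms]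
  by (simp add: compat[OF x])

lemma has_derivative_f\<tau>: "((\<lambda>y. f (\<tau> y)) has_derivative (\<lambda>u. f1 (\<tau> x) * dd \<tau> x u)) (at x)"
  using has_derivative_compose[OF h\<tau> f_deriv[OF x, unfolded has_field_derivative_def]] by simp

lemma has_derivative_f1\<tau>: "((\<lambda>y. f1 (\<tau> y)) has_derivative (\<lambda>u. f2 (\<tau> x) * dd \<tau> x u)) (at x)"
  using has_derivative_compose[OF h\<tau> f1_deriv[OF x, unfolded has_field_derivative_def]] by simp

lemma f_nz: "f (\<tau> x) \<noteq> 0" and a_nz: "a x \<noteq> 0"
  using f_pos[OF x] a_pos[OF x] by auto

lemma has_derivative_\<rho>: "(\<rho> has_derivative (\<lambda>u. \<rho>' x * dd \<tau> x u)) (at x)"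
  unfolding \<rho>_def[abs_def] \<rho>'_def
  by (rule has_derivative_eq_rhs[OF has_derivative_divide[OF has_derivative_f1\<tau> has_derivative_f\<tau> f_nz]])
     (use f_nz in \<open>simp add: fun_eq_iff field_simps power2_eq_square\<close>)

lemma \<rho>f: "f1 (\<tau> x) = \<rho> x * f (\<tau> x)"
  using f_nz by (simp add: \<rho>_def)

text \<open>Both sides of \<open>normal\<close> are differentiated for a fixed v. Compatibility of
  \<Gamma> with \<gamma> collects the terms into \<open>B\<close> and \<open>hess\<close>, and the
  derivative of f^2 produces the \<rho> term.\<close>

lemma \<gamma>B: "(f (\<tau> x))\<^sup>2 * \<gamma> x (B x u) v = dd a x u * dd \<tau> x v + a x * hess x u v - 2 * \<rho> x * a x * dd \<tau> x u * dd \<tau> x v"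
proof -
  have "((\<lambda>y. (f (\<tau> y))\<^sup>2 * \<gamma> y (V y) v) has_derivative (\<lambda>u. (f (\<tau> x))\<^sup>2 * (\<gamma> x (\<Gamma> x u (V x)) v
      + \<gamma> x (V x) (\<Gamma> x u v) + \<gamma> x (dd V x u) v + \<gamma> x (V x) 0)
      + (2 * (f1 (\<tau> x) * dd \<tau> x u) * f (\<tau> x)) * \<gamma> x (V x) v)) (at x)"
    by (rule has_derivative_eq_rhs, rule has_derivative_mult[OF has_derivative_power[OF has_derivative_f\<tau>]
          has_derivative_\<gamma>[OF hV has_derivative_const]]) simp
  then have 1: "((\<lambda>y. a y * dd \<tau> y v) has_derivative (\<lambda>u. (f (\<tau> x))\<^sup>2 * (\<gamma> x (\<Gamma> x u (V x)) v
      + \<gamma> x (V x) (\<Gamma> x u v) + \<gamma> x (dd V x u) v + \<gamma> x (V x) 0)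
      + (2 * (f1 (\<tau> x) * dd \<tau> x u) * f (\<tau> x)) * \<gamma> x (V x) v)) (at x)"
    by (rule has_derivative_transform_within_open[OF _ open_U x]) (rule normal)
  have 2: "((\<lambda>y. a y * dd \<tau> y v) has_derivative
      (\<lambda>u. a x * dd (\<lambda>y. dd \<tau> y v) x u + dd a x u * dd \<tau> x v)) (at x)"
    by (rule has_derivative_mult[OF ha dd_has_derivative[OF d\<tau>_diff[OF x]]])
  have "a x * dd (\<lambda>y. dd \<tau> y v) x u + dd a x u * dd \<tau> x v
    = (f (\<tau> x))\<^sup>2 * (\<gamma> x (\<Gamma> x u (V x)) v
      + \<gamma> x (V x) (\<Gamma> x u v) + \<gamma> x (dd V x u) v + \<gamma> x (V x) 0)
      + (2 * (f1 (\<tau> x) * dd \<tau> x u) * f (\<tau> x)) * \<gamma> x (V x) v"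
    using fun_cong[OF has_derivative_unique[OF 2 1], of u] by (simp only:)
  also have "\<dots> = (f (\<tau> x))\<^sup>2 * \<gamma> x (B x u) v + (f (\<tau> x))\<^sup>2 * \<gamma> x (V x) (\<Gamma> x u v)
     + 2 * \<rho> x * dd \<tau> x u * ((f (\<tau> x))\<^sup>2 * \<gamma> x (V x) v)"
    by (simp add: B_def lin_simps bilinear_rzero[OF \<gamma>b] \<rho>f power2_eq_square algebra_simps)
  finally show ?thesis unfolding normal[OF x] hess_def by (simp add: algebra_simps)
qed

text \<open>The derivative of \<open>unit\<close>, after \<open>normal\<close> has replaced the
  pairing of V with \<open>B x u\<close>.\<close>

lemma a_da: "a x * dd a x u = \<rho> x * ((a x)\<^sup>2 - 1) * dd \<tau> x u + a x * dd \<tau> x (B x u)"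
proof -
  have "((\<lambda>y. (f (\<tau> y))\<^sup>2 * \<gamma> y (V y) (V y)) has_derivative (\<lambda>u. (f (\<tau> x))\<^sup>2 * (\<gamma> x (\<Gamma> x u (V x)) (V x)
      + \<gamma> x (V x) (\<Gamma> x u (V x)) + \<gamma> x (dd V x u) (V x) + \<gamma> x (V x) (dd V x u))
      + (2 * (f1 (\<tau> x) * dd \<tau> x u) * f (\<tau> x)) * \<gamma> x (V x) (V x))) (at x)"
    by (rule has_derivative_eq_rhs, rule has_derivative_mult[OF has_derivative_power[OF has_derivative_f\<tau>]
          has_derivative_\<gamma>[OF hV hV]]) simp
  then have 1: "((\<lambda>y. (a y)\<^sup>2 - 1) has_derivative (\<lambda>u. (f (\<tau> x))\<^sup>2 * (\<gamma> x (\<Gamma> x u (V x)) (V x)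
      + \<gamma> x (V x) (\<Gamma> x u (V x)) + \<gamma> x (dd V x u) (V x) + \<gamma> x (V x) (dd V x u))
      + (2 * (f1 (\<tau> x) * dd \<tau> x u) * f (\<tau> x)) * \<gamma> x (V x) (V x))) (at x)"
    by (rule has_derivative_transform_within_open[OF _ open_U x]) (rule unit)
  have 2: "((\<lambda>y. (a y)\<^sup>2 - 1) has_derivative (\<lambda>u. 2 * a x * dd a x u)) (at x)"
    by (auto intro!: derivative_eq_intros ha)
  have "2 * a x * dd a x u = (f (\<tau> x))\<^sup>2 * (\<gamma> x (\<Gamma> x u (V x)) (V x)
      + \<gamma> x (V x) (\<Gamma> x u (V x)) + \<gamma> x (dd V x u) (V x) + \<gamma> x (V x) (dd V x u))
      + (2 * (f1 (\<tau> x) * dd \<tau> x u) * f (\<tau> x)) * \<gamma> x (V x) (V x)"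
    using fun_cong[OF has_derivative_unique[OF 2 1], of u] by (simp only:)
  also have "\<dots> = 2 * ((f (\<tau> x))\<^sup>2 * \<gamma> x (V x) (B x u))
     + 2 * \<rho> x * dd \<tau> x u * ((f (\<tau> x))\<^sup>2 * \<gamma> x (V x) (V x))"
    by (simp add: B_def lin_simps \<gamma>_sym[OF x, of "dd V x u" "V x"] \<gamma>_sym[OF x, of "\<Gamma> x u (V x)" "V x"] \<rho>f power2_eq_square algebra_simps)
  finally show ?thesis unfolding unit[OF x] unfolding normal[OF x] by (simp add: algebra_simps)
qed

lemma a_d\<tau>V: "a x * dd \<tau> x (V x) = (a x)\<^sup>2 - 1"
  using unit[OF x] normal[OF x, of "V x"] by simp

text \<open>\<open>A\<close> is defined from the fiber component of -\<nabla>_u N alone. The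
  right-hand side is the time component of -\<nabla>_u N, so the immersion carries
  \<open>A x u\<close> to the whole vector.\<close>

lemma d\<tau>A: "dd \<tau> x (A x u) = - dd a x u - \<rho> x * a x * dd \<tau> x u"
proof -
  have "a x * dd \<tau> x (A x u) = - (a x * dd \<tau> x (B x u))
      - \<rho> x * (dd \<tau> x u * (a x * dd \<tau> x (V x)) + (a x)\<^sup>2 * dd \<tau> x u)"
    by (simp add: A_def lin_simps power2_eq_square algebra_simps)
  also have "\<dots> = a x * (- dd a x u - \<rho> x * a x * dd \<tau> x u)"
    using a_da[of u] unfolding a_d\<tau>V by (simp add: power2_eq_square algebra_simps)
  finally show ?thesis using a_nz by simp
qed

lemma gA: "g x (A x u) v = \<kappa> x u v"
proof -
  have "(f (\<tau> x))\<^sup>2 * \<gamma> x (A x u) v = - ((f (\<tau> x))\<^sup>2 * \<gamma> x (B x u) v)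
      - \<rho> x * (dd \<tau> x u * ((f (\<tau> x))\<^sup>2 * \<gamma> x (V x) v) + a x * (f (\<tau> x))\<^sup>2 * \<gamma> x u v)"
    by (simp add: A_def lin_simps algebra_simps)
  then show ?thesis
    unfolding g_def d\<tau>A \<gamma>B normal[OF x] by (simp add: \<kappa>_def \<rho>f power2_eq_square algebra_simps)
qed

lemma hess_sym: "hess x u v = hess x v u"
  unfolding hess_def using dd_commute[OF open_U x \<tau>_diff d\<tau>_diff[OF x]] \<Gamma>_sym[OF x] by metis

lemma \<kappa>_sym: "\<kappa> x u v = \<kappa> x v u"
  unfolding \<kappa>_def using hess_sym[of u v] \<gamma>_sym[OF x, of u v] by simp

lemma g_sym: "g x u v = g x v u"
  unfolding g_def using \<gamma>_sym[OF x, of u v] by simp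

lemma g_bil: "bilinear (g x)"
  by (auto simp: bilinear_def linear_iff g_def lin_simps algebra_simps)

lemma g_pos: "u \<noteq> 0 \<Longrightarrow> g x u u > 0"
  using spacelike[OF x, of u] by (simp add: g_def power2_eq_square)

lemma g_nondegenerate: "(\<And>z. g x w z = 0) \<Longrightarrow> w = 0"
  using g_pos by force

lemma gV: "a x * g x (V x) z = dd \<tau> x z"
proof -
  have "a x * g x (V x) z = a x * ((f (\<tau> x))\<^sup>2 * \<gamma> x (V x) z) - (a x * dd \<tau> x (V x)) * dd \<tau> x z"
    by (simp add: g_def algebra_simps)
  then show ?thesis unfolding normal[OF x] a_d\<tau>V by (simp add: power2_eq_square algebra_simps)
qed

lemma A_adjoint: "g x (A x u) v = g x u (A x v)"
  using gA[of u v] gA[of v u] \<kappa>_sym[of u v] g_sym by metis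

lemma linear_B: "linear (B x)"
  by (auto simp: linear_iff B_def lin_simps algebra_simps)

lemma linear_A: "linear (A x)"
  by (auto simp: linear_iff A_def linear_add[OF linear_B] linear_cmul[OF linear_B] lin_simps algebra_simps)

section \<open>Connection of the induced metric, gradient and traces\<close>

lemma dd_g: "dd (\<lambda>y. g y v z) x u = (f (\<tau> x))\<^sup>2 * (\<gamma> x (\<Gamma> x u v) z + \<gamma> x v (\<Gamma> x u z))
    + 2 * \<rho> x * (f (\<tau> x))\<^sup>2 * dd \<tau> x u * \<gamma> x v z
    - dd (\<lambda>y. dd \<tau> y v) x u * dd \<tau> x z - dd \<tau> x v * dd (\<lambda>y. dd \<tau> y z) x u"
proof -
  have "((\<lambda>y. g y v z) has_derivative (\<lambda>u. ((f (\<tau> x))\<^sup>2 * (\<gamma> x (\<Gamma> x u v) z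
      + \<gamma> x v (\<Gamma> x u z) + \<gamma> x 0 z + \<gamma> x v 0)
      + (of_nat 2 * (f1 (\<tau> x) * dd \<tau> x u) * f (\<tau> x) ^ (2 - 1)) * \<gamma> x v z)
      - (dd \<tau> x v * dd (\<lambda>y. dd \<tau> y z) x u + dd (\<lambda>y. dd \<tau> y v) x u * dd \<tau> x z))) (at x)"
    unfolding g_def
    by (intro has_derivative_diff has_derivative_mult has_derivative_power has_derivative_f\<tau>
        has_derivative_\<gamma>[OF has_derivative_const has_derivative_const] dd_has_derivative d\<tau>_diff x)
  from dd_eqI[OF this] show ?thesis
    by (simp add: bilinear_lzero[OF \<gamma>b] bilinear_rzero[OF \<gamma>b] \<rho>f power2_eq_square algebra_simps)
qed

text \<open>The Gauss formula read in the fiber component. The first terms are the ambient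
  derivative; its tangential part is obtained by adding \<kappa> N, with this sign because N has
  square -1, and the fiber part of N is d\<pi> V.\<close>

lemma christoffel_g:
  "christoffel g x u v = \<Gamma> x u v + \<rho> x *\<^sub>R (dd \<tau> x u *\<^sub>R v + dd \<tau> x v *\<^sub>R u) + \<kappa> x u v *\<^sub>R V x"
proof (rule christoffel_eqI[where h = g and x = x, OF g_bil g_nondegenerate])
  fix z
  note gl = bilinear_ladd[OF g_bil] bilinear_lmul[OF g_bil]
  \<comment> \<open>The factor a of \<open>\<kappa>\<close> is moved next to
    \<open>g x (V x) z\<close>, because it is a V = \<nabla>\<tau> whose pairing with z is
    known.\<close>
  have "\<kappa> x u v * g x (V x) z = - (hess x u v + f (\<tau> x) * f1 (\<tau> x) * \<gamma> x u v - 2 * \<rho> x * dd \<tau> x u * dd \<tau> x v) * (a x * g x (V x) z)"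
    by (simp add: \<kappa>_def algebra_simps)
  then have k: "\<kappa> x u v * g x (V x) z = - (hess x u v + f (\<tau> x) * f1 (\<tau> x) * \<gamma> x u v - 2 * \<rho> x * dd \<tau> x u * dd \<tau> x v) * dd \<tau> x z"
    unfolding gV .
  have c: "dd (\<lambda>y. dd \<tau> y p) x q = dd (\<lambda>y. dd \<tau> y q) x p" for p q
    by (rule dd_commute[OF open_U x \<tau>_diff d\<tau>_diff[OF x]])
  show "g x (\<Gamma> x u v + \<rho> x *\<^sub>R (dd \<tau> x u *\<^sub>R v + dd \<tau> x v *\<^sub>R u) + \<kappa> x u v *\<^sub>R V x) z =
      (dd (\<lambda>y. g y v z) x u + dd (\<lambda>y. g y u z) x v - dd (\<lambda>y. g y u v) x z) / 2"
    unfolding gl real_scaleR_def k dd_g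
    by (simp add: g_def hess_def \<rho>f c[of z u] c[of z v] c[of u v] \<gamma>_sym[OF x, of "\<Gamma> x u z" v]
        \<Gamma>_sym[OF x, of z u] \<Gamma>_sym[OF x, of z v] \<Gamma>_sym[OF x, of v u] lin_simps power2_eq_square algebra_simps)
qed


lemma g_diff: "(\<lambda>y. g y u v) differentiable (at x)"
  unfolding g_def
  by (intro differentiable_diff differentiable_mult differentiable_power d\<tau>_diff \<gamma>_diff x
      differentiableI[OF has_derivative_f\<tau>])

lemma dd_a: "dd a x u = - dd \<tau> x (A x u) - \<rho> x * a x * dd \<tau> x u"
  using d\<tau>A[of u] by simp

lemma B_V: "B x (V x) = - A x (V x) - (\<rho> x * (dd \<tau> x (V x) + a x)) *\<^sub>R V x"
  by (simp add: A_def algebra_simps)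

lemma g_AV: "a x * g x (A x (V x)) z = dd \<tau> x (A x z)"
  using A_adjoint[of "V x" z] gV by simp

lemma g_grad_field: "g x (grad_field x) z = 2 * a x * dd a x z"
proof -
  note gl = bilinear_ladd[OF g_bil] bilinear_lmul[OF g_bil] bilinear_lneg[OF g_bil] bilinear_lsub[OF g_bil]
  have "g x (grad_field x) z = - 2 * a x * (a x * g x (A x (V x)) z)
      - 2 * \<rho> x * (a x * dd \<tau> x (V x) + (a x)\<^sup>2) * (a x * g x (V x) z)
      + 2 * \<rho> x * ((a x)\<^sup>2 - 1) * (a x * g x (V x) z)"
    unfolding grad_field_def B_V gl by (simp add: power2_eq_square algebra_simps)
  then show ?thesis
    unfolding g_AV gV a_d\<tau>V dd_a by (simp add: power2_eq_square algebra_simps)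
qed

text \<open>\<open>endo_trace (B x)\<close> is the divergence of V for \<gamma>; a vanishing trace
  of \<open>A\<close> expresses it through a and \<rho>.\<close>

lemma endo_trace_A: "endo_trace (A x) = - endo_trace (B x) - \<rho> x * (dd \<tau> x (V x) + a x * real DIM('a))"
  unfolding A_def[abs_def]
  by (simp add: endo_trace_diff endo_trace_minus endo_trace_scaleR endo_trace_add
      endo_trace_rank_one[OF lin\<tau>] endo_trace_id)

text \<open>Up to sign, \<open>B\<close> is \<open>A\<close> plus a rank-one map and a multiple of
  the identity. Both rank-one products of \<open>A\<close> with d\<tau> and V have the trace
  \<open>dd \<tau> x (A x (V x))\<close>.\<close>

lemma endo_trace_B_square:
  "endo_trace (\<lambda>u. B x (B x u)) = endo_trace (\<lambda>u. A x (A x u)) + 2 * \<rho> x * a x * endo_trace (A x)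
    + 2 * \<rho> x * dd \<tau> x (A x (V x)) + (\<rho> x)\<^sup>2 * ((dd \<tau> x (V x))\<^sup>2 + 2 * a x * dd \<tau> x (V x) + (a x)\<^sup>2 * real DIM('a))"
proof -
  have B: "B x u = - A x u - \<rho> x *\<^sub>R (dd \<tau> x u *\<^sub>R V x + a x *\<^sub>R u)" for u
    by (simp add: A_def)
  have lA: "linear (\<lambda>u. dd \<tau> x (A x u))"
    using linear_compose[OF linear_A lin\<tau>] by (simp add: o_def)
  have "B x (B x u) = A x (A x u) + \<rho> x *\<^sub>R (dd \<tau> x u *\<^sub>R A x (V x)) + (2 * \<rho> x * a x) *\<^sub>R A x u
      + \<rho> x *\<^sub>R (dd \<tau> x (A x u) *\<^sub>R V x)
      + ((\<rho> x)\<^sup>2 * (dd \<tau> x (V x) + 2 * a x)) *\<^sub>R (dd \<tau> x u *\<^sub>R V x) + ((\<rho> x)\<^sup>2 * (a x)\<^sup>2) *\<^sub>R u" for u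
    unfolding B
    by (simp add: linear_add[OF linear_A] linear_cmul[OF linear_A] linear_diff[OF linear_A] linear_neg[OF linear_A]
        lin_simps power2_eq_square algebra_simps flip: scaleR_add_left)
  then have eq: "(\<lambda>u. B x (B x u)) = (\<lambda>u. A x (A x u) + \<rho> x *\<^sub>R (dd \<tau> x u *\<^sub>R A x (V x)) + (2 * \<rho> x * a x) *\<^sub>R A x u
      + \<rho> x *\<^sub>R (dd \<tau> x (A x u) *\<^sub>R V x)
      + ((\<rho> x)\<^sup>2 * (dd \<tau> x (V x) + 2 * a x)) *\<^sub>R (dd \<tau> x u *\<^sub>R V x) + ((\<rho> x)\<^sup>2 * (a x)\<^sup>2) *\<^sub>R u)"
    by (rule ext)
  show ?thesis
    unfolding eq endo_trace_add endo_trace_scaleR endo_trace_rank_one[OF lin\<tau>] endo_trace_rank_one[OF lA] endo_trace_id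
    by (simp add: power2_eq_square algebra_simps)
qed

end

end

section \<open>The Laplacian of sinh^2 and its lower bound\<close>

context warped_graph
begin

text \<open>The divergence for g is the one for \<Gamma> plus the trace of the difference tensor in
  \<open>christoffel_g\<close>, and \<open>ric\<close> removes the curvature from the Bochner
  identity. The last two terms of the formula are 4 a \<rho> g(A\<nabla>\<tau>, \<nabla>\<tau>) and
  |A\<nabla>\<tau>|^2, because \<nabla>\<tau> = a V.\<close>

lemma divergence_grad_field:
  assumes x: "x \<in> U" and trA: "\<And>y. y \<in> U \<Longrightarrow> endo_trace (A y) = 0"
    and ric: "endo_trace (\<lambda>u. dd (\<lambda>y. \<Gamma> y (V x) (V x)) x u - dd (\<lambda>y. \<Gamma> y u (V x)) x (V x)
          + \<Gamma> x u (\<Gamma> x (V x) (V x)) - \<Gamma> x (V x) (\<Gamma> x u (V x))) = 0"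
  defines "n \<equiv> real DIM('a)" and "s \<equiv> (a x)\<^sup>2 - 1"
  shows "grad_field differentiable (at x)"
    and "endo_trace (\<lambda>u. dd grad_field x u + christoffel g x u (grad_field x)) / 2 =
      (1 + s) * (endo_trace (\<lambda>u. A x (A x u)) + (\<rho> x)\<^sup>2 * (n + 3 * s) - n * \<rho>' x * s)
      + 4 * (a x)\<^sup>2 * \<rho> x * dd \<tau> x (A x (V x)) + (a x)\<^sup>2 * g x (A x (V x)) (A x (V x))"
proof -
  \<comment> \<open>With b for 1/a all terms become polynomials, and the final simplification is an
    identity modulo the single relation a b = 1.\<close>
  define b where "b y = (1 / a y)" for y
  define t where "t = dd \<tau> x (V x)"
  define q where "q = dd \<tau> x (A x (V x))"
  define r where "r = g x (A x (V x)) (A x (V x))"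
  define T where "T = endo_trace (\<lambda>u. A x (A x u))"
  have ab: "a x * b x = 1" using a_nz[OF x] by (simp add: b_def)
  have d\<tau>V: "dd \<tau> y (V y) = a y - 1 / a y" if "y \<in> U" for y
    using a_d\<tau>V[OF that] a_nz[OF that] by (simp add: field_simps power2_eq_square)
  have t: "t = a x - b x" by (simp add: t_def d\<tau>V x b_def)
  \<comment> \<open>As \<open>A\<close> is trace-free on all of U, div V is an explicit function
    there and can be differentiated along V.\<close>
  have trB: "endo_trace (B y) = - \<rho> y * ((n + 1) * a y - 1 / a y)" if "y \<in> U" for y
    using endo_trace_A[OF that] trA[OF that] d\<tau>V[OF that] by (simp add: n_def algebra_simps)
  note div = divergence_of_self_derivative[OF open_U x \<Gamma>_bil \<Gamma>_sym \<Gamma>_diff[OF x] V_diff dV_diff[OF x]]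
  define W where "W y = B y (V y)" for y
  have W: "(W has_derivative dd W x) (at x)"
    using dd_has_derivative[OF div(1)] by (simp add: W_def[abs_def] B_def)
  have "((\<lambda>y. - \<rho> y * ((n + 1) * a y - 1 / a y)) has_derivative
      (\<lambda>u. - \<rho> x * ((n + 1) * dd a x u + dd a x u / (a x)\<^sup>2) - \<rho>' x * dd \<tau> x u * ((n + 1) * a x - 1 / a x))) (at x)"
    by (rule derivative_eq_intros has_derivative_\<rho>[OF x] ha[OF x] a_nz[OF x] refl | simp)+
      (simp add: fun_eq_iff field_simps a_nz[OF x] power2_eq_square)
  then have "((\<lambda>y. endo_trace (B y)) has_derivative
      (\<lambda>u. - \<rho> x * ((n + 1) * dd a x u + dd a x u / (a x)\<^sup>2) - \<rho>' x * dd \<tau> x u * ((n + 1) * a x - 1 / a x))) (at x)"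
    by (rule has_derivative_transform_within_open[OF _ open_U x]) (simp add: trB)
  then have dtrB: "dd (\<lambda>y. endo_trace (B y)) x (V x) =
      - \<rho> x * (n + 1 + (b x)\<^sup>2) * dd a x (V x) - \<rho>' x * t * ((n + 1) * a x - b x)"
    by (simp add: dd_eqI t_def b_def algebra_simps power_divide)
  have DivW: "endo_trace (\<lambda>u. dd W x u + \<Gamma> x u (W x)) =
      dd (\<lambda>y. endo_trace (B y)) x (V x) + endo_trace (\<lambda>u. B x (B x u))"
    using div(2) ric by (simp add: W_def[abs_def] B_def[abs_def])
  have trB2: "endo_trace (\<lambda>u. B x (B x u)) = T + 2 * \<rho> x * q + (\<rho> x)\<^sup>2 * (t\<^sup>2 + 2 * a x * t + (a x)\<^sup>2 * n)"
    using endo_trace_B_square[OF x] trA[OF x] by (simp add: T_def q_def t_def n_def)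
  define \<sigma>' where "\<sigma>' u = \<rho>' x * dd \<tau> x u * ((a x)\<^sup>2 - 1) * a x + \<rho> x * (3 * (a x)\<^sup>2 - 1) * dd a x u" for u
  have \<sigma>: "((\<lambda>y. \<rho> y * ((a y)\<^sup>2 - 1) * a y) has_derivative \<sigma>') (at x)"
    unfolding \<sigma>'_def
    by (rule derivative_eq_intros has_derivative_\<rho>[OF x] ha[OF x] refl | simp)+
      (simp add: fun_eq_iff algebra_simps power2_eq_square)
  have a2: "((\<lambda>y. 2 * (a y)\<^sup>2) has_derivative (\<lambda>u. 4 * a x * dd a x u)) (at x)"
    by (auto intro!: derivative_eq_intros ha[OF x])
  have grad: "(grad_field has_derivative (\<lambda>u. (2 * (a x)\<^sup>2) *\<^sub>R dd W x u + (4 * a x * dd a x u) *\<^sub>R W x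
      + ((2 * (\<rho> x * ((a x)\<^sup>2 - 1) * a x)) *\<^sub>R dd V x u + (2 * \<sigma>' u) *\<^sub>R V x))) (at x)"
    unfolding grad_field_def[abs_def] W_def[symmetric]
    by (intro has_derivative_add has_derivative_scaleR W hV[OF x] a2 has_derivative_mult_right[OF \<sigma>])
  then show "grad_field differentiable (at x)" unfolding differentiable_def by blast
  have lin\<sigma>: "linear \<sigma>'" using \<sigma> has_derivative_linear by blast
  have lin\<kappa>: "linear (\<lambda>u. \<kappa> x u w)" for w
    unfolding gA[OF x, symmetric] using g_bil[OF x] linear_A[OF x] linear_compose
    unfolding bilinear_def by (fastforce simp: o_def)
  let ?X = "grad_field x"
  \<comment> \<open>Sorted into \<nabla>W, \<nabla>V, the identity and rank-one maps, whose traces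
    are all available.\<close>
  have "dd grad_field x u + christoffel g x u ?X =
      (2 * (a x)\<^sup>2) *\<^sub>R (dd W x u + \<Gamma> x u (W x)) + (4 * a x) *\<^sub>R (dd a x u *\<^sub>R W x)
      + (2 * (\<rho> x * ((a x)\<^sup>2 - 1) * a x)) *\<^sub>R B x u + 2 *\<^sub>R (\<sigma>' u *\<^sub>R V x)
      + \<rho> x *\<^sub>R (dd \<tau> x u *\<^sub>R ?X) + (\<rho> x * dd \<tau> x ?X) *\<^sub>R u + \<kappa> x u ?X *\<^sub>R V x" for u
  proof -
    have X: "?X = (2 * (a x)\<^sup>2) *\<^sub>R W x + (2 * (\<rho> x * ((a x)\<^sup>2 - 1) * a x)) *\<^sub>R V x"
      by (simp add: grad_field_def W_def)
    have "\<Gamma> x u ?X = (2 * (a x)\<^sup>2) *\<^sub>R \<Gamma> x u (W x) + (2 * (\<rho> x * ((a x)\<^sup>2 - 1) * a x)) *\<^sub>R \<Gamma> x u (V x)"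
      unfolding X by (simp only: bilinear_radd[OF \<Gamma>b[OF x]] bilinear_rmul[OF \<Gamma>b[OF x]])
    then show ?thesis
      unfolding dd_eqI[OF grad] christoffel_g[OF x] B_def
      by (simp add: scaleR_add_right)
  qed
  then have "endo_trace (\<lambda>u. dd grad_field x u + christoffel g x u ?X) =
      2 * (a x)\<^sup>2 * endo_trace (\<lambda>u. dd W x u + \<Gamma> x u (W x)) + 4 * a x * dd a x (W x)
      + 2 * (\<rho> x * ((a x)\<^sup>2 - 1) * a x) * endo_trace (B x) + 2 * \<sigma>' (V x)
      + \<rho> x * dd \<tau> x ?X + \<rho> x * dd \<tau> x ?X * n + \<kappa> x (V x) ?X"
    by (simp only: endo_trace_add endo_trace_scaleR endo_trace_rank_one[OF lina[OF x]] endo_trace_rank_one[OF lin\<sigma>]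
        endo_trace_rank_one[OF lin\<tau>[OF x]] endo_trace_rank_one[OF lin\<kappa>] endo_trace_id n_def)
  moreover have daV: "dd a x (V x) = - q - \<rho> x * a x * t"
    by (simp add: dd_a[OF x] q_def t_def)
  moreover have daAV: "dd a x (A x (V x)) = - a x * r - \<rho> x * a x * q"
    using g_AV[OF x, of "A x (V x)"] by (simp add: dd_a[OF x] q_def r_def)
  moreover have "dd a x (W x) = - dd a x (A x (V x)) - \<rho> x * (t + a x) * dd a x (V x)"
    unfolding W_def B_V[OF x] t_def
    by (simp add: linear_diff[OF lina[OF x]] linear_neg[OF lina[OF x]] linear_cmul[OF lina[OF x]])
  moreover have d\<tau>W: "dd \<tau> x (W x) = - q - \<rho> x * (t + a x) * t"
    unfolding W_def B_V[OF x] t_def q_def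
    by (simp add: linear_diff[OF lin\<tau>[OF x]] linear_neg[OF lin\<tau>[OF x]] linear_cmul[OF lin\<tau>[OF x]])
  moreover have "dd \<tau> x ?X = 2 * (a x)\<^sup>2 * dd \<tau> x (W x) + 2 * (\<rho> x * ((a x)\<^sup>2 - 1) * a x) * t"
    unfolding grad_field_def W_def t_def
    by (simp add: linear_add[OF lin\<tau>[OF x]] linear_cmul[OF lin\<tau>[OF x]])
  moreover have "\<kappa> x (V x) ?X = 2 * a x * dd a x (A x (V x))"
    using gA[OF x, of "V x" ?X] g_grad_field[OF x, of "A x (V x)"] g_sym[OF x] by metis
  moreover have "endo_trace (B x) = - \<rho> x * ((n + 1) * a x - b x)"
    using trB[OF x] by (simp add: b_def)
  moreover have "\<sigma>' (V x) = \<rho>' x * t * ((a x)\<^sup>2 - 1) * a x + \<rho> x * (3 * (a x)\<^sup>2 - 1) * dd a x (V x)"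
    by (simp add: \<sigma>'_def t_def)
  ultimately have E: "endo_trace (\<lambda>u. dd grad_field x u + christoffel g x u ?X) / 2 =
      (a x)\<^sup>2 * (- \<rho> x * (n + 1 + (b x)\<^sup>2) * (- q - \<rho> x * a x * t) - \<rho>' x * t * ((n + 1) * a x - b x)
        + (T + 2 * \<rho> x * q + (\<rho> x)\<^sup>2 * (t\<^sup>2 + 2 * a x * t + (a x)\<^sup>2 * n)))
      + 2 * a x * (a x * r + \<rho> x * a x * q + \<rho> x * (t + a x) * (q + \<rho> x * a x * t))
      - (\<rho> x * ((a x)\<^sup>2 - 1) * a x) * \<rho> x * ((n + 1) * a x - b x)
      + \<rho>' x * t * ((a x)\<^sup>2 - 1) * a x - \<rho> x * (3 * (a x)\<^sup>2 - 1) * (q + \<rho> x * a x * t)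
      + \<rho> x * (n + 1) * ((a x)\<^sup>2 * (- q - \<rho> x * (t + a x) * t) + (\<rho> x * ((a x)\<^sup>2 - 1) * a x) * t)
      - a x * (a x * r + \<rho> x * a x * q)"
    unfolding DivW dtrB trB2 by (simp add: algebra_simps)
  have alg: "A\<^sup>2 * (- R * (n + 1 + B\<^sup>2) * (- q - R * A * (A - B)) - R' * (A - B) * ((n + 1) * A - B)
        + (T + 2 * R * q + R\<^sup>2 * ((A - B)\<^sup>2 + 2 * A * (A - B) + A\<^sup>2 * n)))
      + 2 * A * (A * r + R * A * q + R * ((A - B) + A) * (q + R * A * (A - B)))
      - (R * (A\<^sup>2 - 1) * A) * R * ((n + 1) * A - B)
      + R' * (A - B) * (A\<^sup>2 - 1) * A - R * (3 * A\<^sup>2 - 1) * (q + R * A * (A - B))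
      + R * (n + 1) * (A\<^sup>2 * (- q - R * ((A - B) + A) * (A - B)) + (R * (A\<^sup>2 - 1) * A) * (A - B))
      - A * (A * r + R * A * q)
    = A\<^sup>2 * (T + R\<^sup>2 * (n + 3 * (A\<^sup>2 - 1)) - n * R' * (A\<^sup>2 - 1)) + 4 * A\<^sup>2 * R * q + A\<^sup>2 * r"
    if "A * B = 1" for A B R R' :: real
    using that by algebra
  show "endo_trace (\<lambda>u. dd grad_field x u + christoffel g x u (grad_field x)) / 2 =
      (1 + s) * (endo_trace (\<lambda>u. A x (A x u)) + (\<rho> x)\<^sup>2 * (n + 3 * s) - n * \<rho>' x * s)
      + 4 * (a x)\<^sup>2 * \<rho> x * dd \<tau> x (A x (V x)) + (a x)\<^sup>2 * g x (A x (V x)) (A x (V x))"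
    using E alg[OF ab, of "\<rho> x" "\<rho>' x"]
    unfolding t s_def T_def[symmetric] q_def[symmetric] r_def[symmetric] by simp
qed

lemma g_nonneg: "x \<in> U \<Longrightarrow> g x u u \<ge> 0"
  using g_pos[of x u] bilinear_lzero[OF g_bil] by (cases "u = 0") (auto simp: less_imp_le)

lemma cauchy_schwarz_g:
  assumes x: "x \<in> U"
  shows "(g x u v)\<^sup>2 \<le> g x u u * g x v v"
proof (cases "u = 0")
  case True
  then show ?thesis using g_bil[OF x] by (simp add: bilinear_lzero)
next
  case False
  note gl = bilinear_lsub[OF g_bil[OF x]] bilinear_rsub[OF g_bil[OF x]] bilinear_lmul[OF g_bil[OF x]] bilinear_rmul[OF g_bil[OF x]]
  have p: "g x u u > 0" using g_pos[OF x False] .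
  have "0 \<le> g x (g x u u *\<^sub>R v - g x u v *\<^sub>R u) (g x u u *\<^sub>R v - g x u v *\<^sub>R u)"
    by (rule g_nonneg[OF x])
  also have "\<dots> = g x u u * (g x u u * g x v v - (g x u v)\<^sup>2)"
    by (simp add: gl g_sym[OF x, of v u] power2_eq_square algebra_simps)
  finally show ?thesis using p by (simp add: zero_le_mult_iff)
qed

text \<open>\<open>h\<close> and \<open>\<phi>\<close> stand for the chart expressions of the
  induced metric and of sinh^2. They are controlled only on U, so their derivatives are compared
  with those of \<open>g\<close> and a^2 - 1 through equality on an open set.\<close>

theorem laplacian_inequality:
  assumes x: "x \<in> U" and trA: "\<And>y. y \<in> U \<Longrightarrow> endo_trace (A y) = 0"
    and ric: "endo_trace (\<lambda>u. dd (\<lambda>y. \<Gamma> y (V x) (V x)) x u - dd (\<lambda>y. \<Gamma> y u (V x)) x (V x)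
          + \<Gamma> x u (\<Gamma> x (V x) (V x)) - \<Gamma> x (V x) (\<Gamma> x u (V x))) = 0"
    and n: "DIM('a) \<ge> 2" and ncc: "\<rho>' x \<le> 0"
    and h: "\<And>y u v. y \<in> U \<Longrightarrow> h y u v = g y u v" and \<phi>: "\<And>y. y \<in> U \<Longrightarrow> \<phi> y = (a y)\<^sup>2 - 1"
  shows "1/2 * divergence h (gradient h \<phi>) x \<ge>
    ((real DIM('a) + 1) * (f1 (\<tau> x))\<^sup>2 / (f (\<tau> x))\<^sup>2 - real DIM('a) * f2 (\<tau> x) / f (\<tau> x)) * ((a x)\<^sup>2 - 1)\<^sup>2"
proof -
  define n where "n = real DIM('a)"
  define s where "s = (a x)\<^sup>2 - 1"
  have d\<phi>: "dd \<phi> y z = 2 * a y * dd a y z" if "y \<in> U" for y z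
  proof -
    have "((\<lambda>y. (a y)\<^sup>2 - 1) has_derivative (\<lambda>u. 2 * a y * dd a y u)) (at y)"
      by (auto intro!: derivative_eq_intros ha[OF that])
    then have "(\<phi> has_derivative (\<lambda>u. 2 * a y * dd a y u)) (at y)"
      by (rule has_derivative_transform_within_open[OF _ open_U that]) (simp add: \<phi>)
    then show ?thesis by (rule dd_eqI)
  qed
  have hg: "h y = g y" if "y \<in> U" for y using h[OF that] by (simp add: fun_eq_iff)
  have grad: "gradient h \<phi> y = grad_field y" if "y \<in> U" for y
    unfolding gradient_def hg[OF that]
    using gradient_eqI[where h = g and x = y and u = \<phi>, OF g_bil[OF that] g_nondegenerate[OF that]]
    unfolding gradient_def by (simp add: g_grad_field[OF that] d\<phi>[OF that])
  have dh: "dd (\<lambda>y. h y u v) x = dd (\<lambda>y. g y u v) x" for u v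
    using dd_cong_open[OF g_diff[OF x] open_U x, of u v "\<lambda>y. h y u v"] h by simp
  have chr: "christoffel h x u v = christoffel g x u v" for u v
    unfolding christoffel_def dh hg[OF x] ..
  have dgrad: "dd (gradient h \<phi>) x = dd grad_field x"
    using dd_cong_open[OF divergence_grad_field(1)[OF x trA ric] open_U x, of "gradient h \<phi>"] grad by simp
  have "divergence h (gradient h \<phi>) x = endo_trace (\<lambda>u. dd grad_field x u + christoffel g x u (grad_field x))"
    unfolding divergence_def covariant_derivative_along_def[abs_def] dgrad chr grad[OF x] by simp
  then have div: "1/2 * divergence h (gradient h \<phi>) x =
      (1 + s) * (endo_trace (\<lambda>u. A x (A x u)) + (\<rho> x)\<^sup>2 * (n + 3 * s) - n * \<rho>' x * s)
      + 4 * (a x)\<^sup>2 * \<rho> x * dd \<tau> x (A x (V x)) + (a x)\<^sup>2 * g x (A x (V x)) (A x (V x))"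
    using divergence_grad_field(2)[OF x trA ric] by (simp add: n_def s_def)
  define T where "T = endo_trace (\<lambda>u. A x (A x u))"
  define p where "p = a x * dd \<tau> x (A x (V x))"
  define R where "R = (a x)\<^sup>2 * g x (A x (V x)) (A x (V x))"
  \<comment> \<open>Z is \<nabla>\<tau>, of squared length s; p and R are g(AZ, Z) and g(AZ,
    AZ).\<close>
  define Z where "Z = a x *\<^sub>R V x"
  note gl = bilinear_lmul[OF g_bil[OF x]] bilinear_rmul[OF g_bil[OF x]]
  have gZZ: "g x Z Z = s"
    using gV[OF x, of "V x"] a_d\<tau>V[OF x] by (simp add: Z_def gl s_def)
  have AZ: "A x Z = a x *\<^sub>R A x (V x)" by (simp add: Z_def linear_cmul[OF linear_A[OF x]])
  have gAZZ: "g x (A x Z) Z = p"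
    using g_AV[OF x, of "V x"] unfolding AZ by (simp add: Z_def gl p_def)
  have gAZAZ: "g x (A x Z) (A x Z) = R"
    unfolding AZ by (simp add: gl R_def power2_eq_square)
  have s: "s \<ge> 0" "R \<ge> 0" "T \<ge> 0"
    using g_nonneg[OF x, of Z] g_nonneg[OF x, of "A x Z"] gZZ gAZAZ
      endo_trace_square_self_adjoint_nonneg[where g = "g x" and C = "A x", OF g_bil[OF x] g_sym[OF x] g_pos[OF x] linear_A[OF x] A_adjoint[OF x]]
    by (simp_all add: T_def)
  have "p\<^sup>2 \<le> s\<^sup>2 * T"
    using endo_trace_square_self_adjoint_ge[where g = "g x" and A = "A x" and w = Z,
        OF g_bil[OF x] g_sym[OF x] g_pos[OF x] linear_A[OF x] A_adjoint[OF x]]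
    by (simp add: gZZ gAZZ T_def)
  moreover have "p\<^sup>2 \<le> s * R"
    using cauchy_schwarz_g[OF x, of "A x Z" Z] by (simp add: gZZ gAZZ gAZAZ mult.commute)
  ultimately have I: "(1 + s) * (T + (\<rho> x)\<^sup>2 * (n + 3 * s)) + 4 * a x * \<rho> x * p + R \<ge> (\<rho> x)\<^sup>2 * s\<^sup>2"
    using s n by (intro scalar_inequality) (auto simp: s_def n_def)
  \<comment> \<open>Null convergence enters here: the nonnegative term
    \<open>- n * \<rho>' x * s\<close> is dropped from
    \<open>- n * \<rho>' x * s * (1 + s)\<close>.\<close>
  have "n * \<rho>' x * s * (1 + s) \<le> n * \<rho>' x * s * s"
    using ncc s(1) by (simp add: algebra_simps n_def mult_nonneg_nonpos)
  then have "1/2 * divergence h (gradient h \<phi>) x \<ge> (\<rho> x)\<^sup>2 * s\<^sup>2 - n * \<rho>' x * s * s"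
    unfolding div T_def[symmetric] R_def[symmetric] using I by (simp add: p_def power2_eq_square algebra_simps)
  \<comment> \<open>As f''/f is \<rho>' + \<rho>^2, the number (n + 1) \<rho>^2 - n f''/f equals
    \<rho>^2 - n \<rho>'; this is the origin of n + 1.\<close>
  moreover have "((n + 1) * (f1 (\<tau> x))\<^sup>2 / (f (\<tau> x))\<^sup>2 - n * f2 (\<tau> x) / f (\<tau> x)) * s\<^sup>2
      = (\<rho> x)\<^sup>2 * s\<^sup>2 - n * \<rho>' x * s * s"
    by (simp add: \<rho>_def \<rho>'_def power2_eq_square algebra_simps add_divide_distrib)
  ultimately show ?thesis unfolding n_def s_def by simp
qed

end

section \<open>Riemannian metrics and warped products on open sets\<close>

text \<open>The expansion in a basis has coefficients that do not depend on the base point, so it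
  survives differentiation.\<close>

lemma dd_bilinear_family:
  fixes \<beta> :: "'w::real_normed_vector \<Rightarrow> 'a::euclidean_space \<Rightarrow> 'b::euclidean_space \<Rightarrow> 'c::real_normed_vector"
  assumes W: "open W" "x \<in> W" and bil: "\<And>y. y \<in> W \<Longrightarrow> bilinear (\<beta> y)"
    and \<beta>: "\<And>u v. (\<lambda>y. \<beta> y u v) differentiable (at x)"
  shows "bilinear (\<lambda>u v. dd (\<lambda>y. \<beta> y u v) x z)"
proof -
  have "dd (\<lambda>y. \<beta> y u v) x z = (\<Sum>b\<in>Basis. \<Sum>c\<in>Basis. ((u \<bullet> b) * (v \<bullet> c)) *\<^sub>R dd (\<lambda>y. \<beta> y b c) x z)" for u v
  proof -
    have "((\<lambda>y. \<Sum>b\<in>Basis. \<Sum>c\<in>Basis. ((u \<bullet> b) * (v \<bullet> c)) *\<^sub>R \<beta> y b c) has_derivative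
      (\<lambda>z. \<Sum>b\<in>Basis. \<Sum>c\<in>Basis. ((u \<bullet> b) * (v \<bullet> c)) *\<^sub>R dd (\<lambda>y. \<beta> y b c) x z)) (at x)"
      by (intro has_derivative_sum has_derivative_scaleR_right dd_has_derivative \<beta>)
    then have "((\<lambda>y. \<beta> y u v) has_derivative
      (\<lambda>z. \<Sum>b\<in>Basis. \<Sum>c\<in>Basis. ((u \<bullet> b) * (v \<bullet> c)) *\<^sub>R dd (\<lambda>y. \<beta> y b c) x z)) (at x)"
      by (rule has_derivative_transform_within_open[OF _ W]) (rule bilinear_expand[OF bil, symmetric])
    then show ?thesis by (rule dd_eqI)
  qed
  then have "(\<lambda>u v. dd (\<lambda>y. \<beta> y u v) x z) =
      (\<lambda>u v. \<Sum>b\<in>Basis. \<Sum>c\<in>Basis. ((u \<bullet> b) * (v \<bullet> c)) *\<^sub>R dd (\<lambda>y. \<beta> y b c) x z)"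
    by (intro ext)
  then show ?thesis
    by (simp only:) (simp add: bilinear_def linear_iff inner_add_left scaleR_sum_right scaleR_add_left
        distrib_left distrib_right sum.distrib mult_ac)
qed

text \<open>The fiber metric in one chart. The model space is \<open>real ^ 'n\<close> from here on,
  so that Cramer's rule applies to the equations for the Christoffel symbols.\<close>

locale local_metric =
  fixes W :: "(real ^ 'n) set" and G :: "real ^ 'n \<Rightarrow> real ^ 'n \<Rightarrow> real ^ 'n \<Rightarrow> real"
  assumes open_W: "open W" and G_bil: "y \<in> W \<Longrightarrow> bilinear (G y)"
    and G_sym: "y \<in> W \<Longrightarrow> G y u v = G y v u" and G_pos: "y \<in> W \<Longrightarrow> u \<noteq> 0 \<Longrightarrow> G y u u > 0"
    and G_smooth: "smooth_on W (\<lambda>y. G y u v)"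
begin

section \<open>Christoffel symbols from the Koszul formula\<close>

definition "koszul y u v z = (dd (\<lambda>y. G y v z) y u + dd (\<lambda>y. G y u z) y v - dd (\<lambda>y. G y u v) y z) / 2"

text \<open>Lowering of an index, with covectors turned into vectors by the Euclidean inner product.
  It makes the Koszul formula a linear system for the Christoffel symbol.\<close>

definition "flat y w = (\<Sum>b\<in>Basis. G y w b *\<^sub>R b)"

lemma G_diff: "y \<in> W \<Longrightarrow> (\<lambda>y. G y u v) differentiable (at y)"
  using smooth_on_differentiable[OF G_smooth] .

lemma dG_diff: "y \<in> W \<Longrightarrow> (\<lambda>y. dd (\<lambda>y. G y u v) y w) differentiable (at y)"
  using smooth_on_differentiable[OF smooth_on_dd[OF G_smooth]] .

lemma dG_bil: "y \<in> W \<Longrightarrow> bilinear (\<lambda>u v. dd (\<lambda>y. G y u v) y w)"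
  by (rule dd_bilinear_family[OF open_W _ G_bil G_diff])

lemma dG_sym: "y \<in> W \<Longrightarrow> dd (\<lambda>y. G y u v) y w = dd (\<lambda>y. G y v u) y w"
  by (rule fun_cong[where x = w], rule dd_cong_open[OF G_diff open_W]) (auto intro: G_sym)

lemma dG_lin: "y \<in> W \<Longrightarrow> linear (dd (\<lambda>y. G y u v) y)"
  by (rule linear_dd[OF G_diff])

lemma G_nondegenerate: "y \<in> W \<Longrightarrow> (\<And>z. G y w z = 0) \<Longrightarrow> w = 0"
  using G_pos by force

lemma G_eqI:
  assumes "y \<in> W" "\<And>z. G y w z = G y w' z"
  shows "w = w'"
  using G_nondegenerate[OF assms(1), of "w - w'"] assms(2) by (simp add: bilinear_lsub[OF G_bil[OF assms(1)]])

lemma linear_flat: "y \<in> W \<Longrightarrow> linear (flat y)"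
  unfolding flat_def
  by (auto simp: linear_iff bilinear_ladd[OF G_bil] bilinear_lmul[OF G_bil] algebra_simps sum.distrib scaleR_sum_right)

lemma inner_flat: "y \<in> W \<Longrightarrow> flat y w \<bullet> z = G y w z"
  using linear_expand[of "G y w" z] G_bil[of y]
  by (simp add: flat_def inner_sum_left bilinear_def inner_commute[of z] mult.commute)

lemma inj_flat: "y \<in> W \<Longrightarrow> inj (flat y)"
  by (metis injI G_eqI inner_flat)

lemma koszul_linear: 
  assumes y: "y \<in> W"
  shows "linear (koszul y u v)" "linear (\<lambda>u. koszul y u v z)"
  using dG_bil[OF y] dG_lin[OF y] unfolding koszul_def bilinear_def linear_iff
  by (auto simp: algebra_simps add_divide_distrib diff_divide_distrib)

lemma koszul_sym: "y \<in> W \<Longrightarrow> koszul y u v z = koszul y v u z"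
  unfolding koszul_def using dG_sym[of y u v z] by simp

lemma flat_solve:
  assumes "y \<in> W" "linear l"
  obtains w where "\<And>z. G y w z = l z" "flat y w = (\<Sum>b\<in>Basis. l b *\<^sub>R b)"
proof -
  obtain w where w: "flat y w = (\<Sum>b\<in>Basis. l b *\<^sub>R b)"
    using linear_injective_imp_surjective[OF linear_flat inj_flat] assms(1) by (metis surjD)
  have "G y w z = l z" for z
    using inner_flat[OF assms(1), of w z] linear_expand[OF assms(2), of z]
    by (simp add: w inner_sum_left inner_commute[of z] mult.commute)
  then show ?thesis using that w by blast
qed

text \<open>Lowering is injective, hence surjective, so the vector sought by \<open>THE\<close>
  exists; all properties of \<open>christoffel\<close> are derived from this equation.\<close>

lemma G_christoffel:
  assumes y: "y \<in> W"
  shows "G y (christoffel G y u v) z = koszul y u v z"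
proof -
  obtain w where w: "\<And>z. G y w z = koszul y u v z"
    using flat_solve[OF y koszul_linear(1)[OF y]] by metis
  have "christoffel G y u v = w"
    by (rule christoffel_eqI[where h = G and x = y, OF G_bil[OF y] G_nondegenerate[OF y]])
       (simp_all add: w koszul_def)
  then show ?thesis using w by simp
qed

lemma flat_christoffel: "y \<in> W \<Longrightarrow> flat y (christoffel G y u v) = (\<Sum>b\<in>Basis. koszul y u v b *\<^sub>R b)"
  unfolding flat_def by (simp add: G_christoffel)

lemma christoffel_sym: "y \<in> W \<Longrightarrow> christoffel G y u v = christoffel G y v u"
  by (rule G_eqI) (auto simp: G_christoffel koszul_sym)

lemma christoffel_bil:
  assumes y: "y \<in> W"
  shows "bilinear (christoffel G y)"
proof -
  note gl = bilinear_ladd[OF G_bil[OF y]] bilinear_lmul[OF G_bil[OF y]]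
  have l: "linear (\<lambda>u. christoffel G y u v)" for v
    unfolding linear_iff
    by (auto intro!: G_eqI[OF y] simp: gl G_christoffel[OF y] linear_add[OF koszul_linear(2)[OF y]]
        linear_cmul[OF koszul_linear(2)[OF y]])
  moreover have "linear (christoffel G y u)" for u
    using l[of u] by (simp add: christoffel_sym[OF y, of _ u])
  ultimately show ?thesis unfolding bilinear_def by blast
qed

lemma christoffel_diff:
  assumes y: "y \<in> W"
  shows "(\<lambda>y. christoffel G y u v) differentiable (at y)"
proof (rule differentiable_linear_system[OF open_W y linear_flat inj_flat])
  show "(\<lambda>y. flat y w) differentiable (at y)" for w
    unfolding flat_def
    by (auto intro!: differentiable_sum differentiable_scaleR G_diff y)
  show "(\<lambda>y. \<Sum>b\<in>Basis. koszul y u v b *\<^sub>R b) differentiable (at y)"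
    unfolding koszul_def
    by (auto intro!: differentiable_sum differentiable_scaleR differentiable_divide differentiable_add differentiable_diff dG_diff y)
qed (simp_all add: flat_christoffel)

lemma metric_compatible:
  assumes y: "y \<in> W"
  shows "dd (\<lambda>y. G y v w) y u = G y (christoffel G y u v) w + G y v (christoffel G y u w)"
  unfolding G_sym[OF y, of v "christoffel G y u w"] G_christoffel[OF y] koszul_def
  by (simp add: dG_sym[OF y, of w v] dG_sym[OF y, of w u] dG_sym[OF y, of v u] field_simps)

text \<open>Needed to conjugate the Ricci trace by d\<pi>.\<close>

lemma curvature_linear:
  assumes y: "y \<in> W"
  shows "linear (\<lambda>u. curvature G y u v w)"
proof -
  have b: "bilinear (\<lambda>u v. dd (\<lambda>y. christoffel G y u v) y z)" for z
    by (rule dd_bilinear_family[OF open_W y christoffel_bil christoffel_diff[OF y]])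
  have "linear (dd (\<lambda>y. christoffel G y v w) y)" by (rule linear_dd[OF christoffel_diff[OF y]])
  moreover have "linear (\<lambda>u. dd (\<lambda>y. christoffel G y u w) y v)" using b unfolding bilinear_def by blast
  moreover have "linear (\<lambda>u. christoffel G y u w)" for w using christoffel_bil[OF y] unfolding bilinear_def by blast
  moreover have "linear (christoffel G y v)" using christoffel_bil[OF y] unfolding bilinear_def by blast
  ultimately show ?thesis
    unfolding curvature_def linear_iff by (simp add: algebra_simps)
qed

end

section \<open>Curvature of the warped product and null convergence\<close>

locale warped_product = local_metric W G
  for W :: "(real ^ 'n) set" and G +
  fixes I :: "real set" and f f1 f2 :: "real \<Rightarrow> real"
  assumes open_I: "open I" and f_deriv: "t \<in> I \<Longrightarrow> (f has_real_derivative f1 t) (at t)"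
    and f1_deriv: "t \<in> I \<Longrightarrow> (f1 has_real_derivative f2 t) (at t)" and f_pos: "t \<in> I \<Longrightarrow> f t > 0"
begin

definition h :: "real \<times> (real ^ 'n) \<Rightarrow> real \<times> (real ^ 'n) \<Rightarrow> real \<times> (real ^ 'n) \<Rightarrow> real"
  where "h q u v = - (fst u * fst v) + (f (fst q))\<^sup>2 * G (snd q) (snd u) (snd v)"

definition "\<rho> t = f1 t / f t"
definition "\<rho>' t = f2 t / f t - (\<rho> t)\<^sup>2"

lemma \<rho>_deriv: "t \<in> I \<Longrightarrow> (\<rho> has_real_derivative \<rho>' t) (at t)"
  unfolding \<rho>_def[abs_def] \<rho>'_def using f_pos[of t]
  by (auto intro!: derivative_eq_intros f_deriv f1_deriv simp: field_simps power2_eq_square)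

lemma dd_h:
  assumes "t \<in> I" "y \<in> W"
  shows "dd (\<lambda>q. h q v z) (t, y) u = 2 * f t * f1 t * fst u * G y (snd v) (snd z)
    + (f t)\<^sup>2 * dd (\<lambda>y. G y (snd v) (snd z)) y (snd u)"
proof -
  have 1: "((\<lambda>q. f (fst q)) has_derivative (\<lambda>u. f1 t * fst u)) (at (t, y))"
    using has_derivative_compose[of fst fst "(t, y)" UNIV f "(*) (f1 t)"] f_deriv[OF assms(1)]
    by (simp add: has_field_derivative_def bounded_linear_fst bounded_linear_imp_has_derivative)
  have 2: "((\<lambda>q. G (snd q) (snd v) (snd z)) has_derivative (\<lambda>u. dd (\<lambda>y. G y (snd v) (snd z)) y (snd u))) (at (t, y))"
    using has_derivative_compose[of snd snd "(t, y)" UNIV "\<lambda>y. G y (snd v) (snd z)"] dd_has_derivative[OF G_diff[OF assms(2)]]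
    by (simp add: bounded_linear_snd bounded_linear_imp_has_derivative)
  have "((\<lambda>q. h q v z) has_derivative (\<lambda>u. 2 * f t * f1 t * fst u * G y (snd v) (snd z)
    + (f t)\<^sup>2 * dd (\<lambda>y. G y (snd v) (snd z)) y (snd u))) (at (t, y))"
    unfolding h_def by (auto intro!: derivative_eq_intros 1 2 simp: fun_eq_iff)
  then show ?thesis by (rule dd_eqI)
qed

lemma h_bil: "snd q \<in> W \<Longrightarrow> bilinear (h q)"
  by (auto simp: bilinear_def linear_iff h_def bilinear_ladd[OF G_bil] bilinear_lmul[OF G_bil]
      bilinear_radd[OF G_bil] bilinear_rmul[OF G_bil] algebra_simps)

lemma h_nondegenerate:
  assumes q: "fst q \<in> I" "snd q \<in> W" and w: "\<And>z. h q w z = 0"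
  shows "w = 0"
proof -
  have "fst w = 0" using w[of "(1, 0)"] by (simp add: h_def bilinear_rzero[OF G_bil[OF q(2)]])
  moreover have "snd w = 0" using w[of "(0, z)" for z] f_pos[OF q(1)]
    by (intro G_nondegenerate[OF q(2)]) (simp add: h_def)
  ultimately show ?thesis by (simp add: prod_eq_iff)
qed

lemma christoffel_h:
  assumes t: "t \<in> I" and y: "y \<in> W"
  shows "christoffel h (t, y) u v = (f t * f1 t * G y (snd u) (snd v),
    christoffel G y (snd u) (snd v) + \<rho> t *\<^sub>R (fst u *\<^sub>R snd v + fst v *\<^sub>R snd u))"
proof (rule christoffel_eqI[where h = h and x = "(t, y)"])
  show "bilinear (h (t, y))" using h_bil y by simp
  show "\<And>w. (\<And>z. h (t, y) w z = 0) \<Longrightarrow> w = 0" using h_nondegenerate[of "(t, y)"] t y by simp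
  have \<rho>f: "f1 t = \<rho> t * f t" using f_pos[OF t] by (simp add: \<rho>_def)
  note gl = bilinear_ladd[OF G_bil[OF y]] bilinear_lmul[OF G_bil[OF y]]
  fix z
  show "h (t, y) (f t * f1 t * G y (snd u) (snd v),
      christoffel G y (snd u) (snd v) + \<rho> t *\<^sub>R (fst u *\<^sub>R snd v + fst v *\<^sub>R snd u)) z =
    (dd (\<lambda>q. h q v z) (t, y) u + dd (\<lambda>q. h q u z) (t, y) v - dd (\<lambda>q. h q u v) (t, y) z) / 2"
    unfolding dd_h[OF t y]
    by (simp add: h_def gl G_christoffel[OF y] koszul_def \<rho>f field_simps power2_eq_square)
qed

lemma dd_christoffel_h:
  assumes t: "t \<in> I" and y: "y \<in> W"
  shows "dd (\<lambda>q. christoffel h q u v) (t, y) w =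
    (((f1 t)\<^sup>2 + f t * f2 t) * fst w * G y (snd u) (snd v) + f t * f1 t * dd (\<lambda>y. G y (snd u) (snd v)) y (snd w),
     dd (\<lambda>y. christoffel G y (snd u) (snd v)) y (snd w) + (\<rho>' t * fst w) *\<^sub>R (fst u *\<^sub>R snd v + fst v *\<^sub>R snd u))"
proof -
  let ?p = "fst u *\<^sub>R snd v + fst v *\<^sub>R snd u"
  have fstc: "((\<lambda>q. k (fst q)) has_derivative (\<lambda>u. k' * fst u)) (at (t, y))"
    if "(k has_real_derivative k') (at t)" for k k'
    using has_derivative_compose[of fst fst "(t, y)" UNIV k "(*) k'"] that
    by (simp add: has_field_derivative_def bounded_linear_fst bounded_linear_imp_has_derivative)
  have sndc: "((\<lambda>q. k (snd q)) has_derivative (\<lambda>u. dd k y (snd u))) (at (t, y))"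
    if "k differentiable (at y)" for k :: "_ \<Rightarrow> 'z::real_normed_vector"
    using has_derivative_compose[of snd snd "(t, y)" UNIV k] dd_has_derivative[OF that]
    by (simp add: bounded_linear_snd bounded_linear_imp_has_derivative)
  have 1: "((\<lambda>q. f (fst q) * f1 (fst q) * G (snd q) (snd u) (snd v)) has_derivative
     (\<lambda>w. ((f1 t)\<^sup>2 + f t * f2 t) * fst w * G y (snd u) (snd v) + f t * f1 t * dd (\<lambda>y. G y (snd u) (snd v)) y (snd w))) (at (t, y))"
    by (rule has_derivative_eq_rhs, rule has_derivative_mult[OF has_derivative_mult[OF fstc[OF f_deriv[OF t]] fstc[OF f1_deriv[OF t]]]
          sndc[OF G_diff[OF y]]]) (simp add: fun_eq_iff power2_eq_square algebra_simps)
  have 2: "((\<lambda>q. christoffel G (snd q) (snd u) (snd v) + \<rho> (fst q) *\<^sub>R ?p) has_derivative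
     (\<lambda>w. dd (\<lambda>y. christoffel G y (snd u) (snd v)) y (snd w) + (\<rho>' t * fst w) *\<^sub>R ?p)) (at (t, y))"
    by (intro has_derivative_add has_derivative_scaleR_left sndc[OF christoffel_diff[OF y]] fstc[OF \<rho>_deriv[OF t]])
  have "((\<lambda>q. christoffel h q u v) has_derivative
     (\<lambda>w. (((f1 t)\<^sup>2 + f t * f2 t) * fst w * G y (snd u) (snd v) + f t * f1 t * dd (\<lambda>y. G y (snd u) (snd v)) y (snd w),
     dd (\<lambda>y. christoffel G y (snd u) (snd v)) y (snd w) + (\<rho>' t * fst w) *\<^sub>R ?p))) (at (t, y))"
    by (rule has_derivative_transform_within_open[OF has_derivative_Pair[OF 1 2] open_Times[OF open_I open_W]])
       (use t y in \<open>auto simp: christoffel_h\<close>)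
  then show ?thesis by (rule dd_eqI)
qed

text \<open>The time entry of the trace is f''/f = \<rho>' + \<rho>^2. On the fiber, the operator is
  the fiber curvature minus \<rho>' times the identity minus a rank-one map of trace \<rho>^2. In
  the sum \<rho>^2 cancels and one of the n copies of \<rho>' is compensated.\<close>

lemma ricci_h_null:
  assumes t: "t \<in> I" and y: "y \<in> W" and e: "(f t)\<^sup>2 * G y e e = 1"
  shows "ricci h (t, y) (1, e) (1, e) = ricci G y e e - (real CARD('n) - 1) * \<rho>' t"
proof -
  let ?z = "(1::real, e)"
  have f: "f t > 0" using f_pos[OF t] .
  note b = christoffel_bil[OF y]
  note bs = bilinear_ladd[OF b] bilinear_radd[OF b] bilinear_lmul[OF b] bilinear_rmul[OF b] bilinear_lzero[OF b] bilinear_rzero[OF b]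
  note gs = bilinear_ladd[OF G_bil[OF y]] bilinear_radd[OF G_bil[OF y]] bilinear_lmul[OF G_bil[OF y]] bilinear_rmul[OF G_bil[OF y]]
     bilinear_lzero[OF G_bil[OF y]] bilinear_rzero[OF G_bil[OF y]]
  have dz: "dd (\<lambda>y. christoffel G y 0 v) y w = 0" "dd (\<lambda>y. G y 0 v) y w = 0" for v w
    using dd_bilinear_family[OF open_W y christoffel_bil christoffel_diff[OF y]] dG_bil[OF y]
    by (auto simp: bilinear_lzero[where h = "\<lambda>u v. dd (\<lambda>y. christoffel G y u v) y w"]
        bilinear_lzero[where h = "\<lambda>u v. dd (\<lambda>y. G y u v) y w"])
  have dl: "dd (\<lambda>y. christoffel G y u v) y 0 = 0" "dd (\<lambda>y. G y u v) y 0 = 0" for u v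
    using linear_0[OF linear_dd[OF christoffel_diff[OF y]]] linear_0[OF dG_lin[OF y]] by blast+
  have 1: "fst (curvature h (t, y) (1, 0) ?z ?z) = f2 t / f t"
  proof -
    have "fst (curvature h (t, y) (1, 0) ?z ?z) = f t * f2 t * G y e e + ((f1 t)\<^sup>2 - f t * f1 t * \<rho> t) * G y e e"
      unfolding curvature_def dd_christoffel_h[OF t y] christoffel_h[OF t y]
      by (simp add: bs gs dz dl algebra_simps)
    also have "f t * f1 t * \<rho> t = (f1 t)\<^sup>2" using f by (simp add: \<rho>_def power2_eq_square)
    also have "f t * f2 t * G y e e + ((f1 t)\<^sup>2 - (f1 t)\<^sup>2) * G y e e = (f2 t / f t) * ((f t)\<^sup>2 * G y e e)"
      using f by (simp add: power2_eq_square)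
    finally show ?thesis using e by simp
  qed
  have r2: "f t * f1 t * \<rho> t * G y e e = (\<rho> t)\<^sup>2"
  proof -
    have "f t * f1 t * \<rho> t * G y e e = (\<rho> t)\<^sup>2 * ((f t)\<^sup>2 * G y e e)"
      using f by (simp add: \<rho>_def power2_eq_square)
    then show ?thesis using e by simp
  qed
  \<comment> \<open>\<open>e * 2\<close> is the componentwise product on \<open>real ^ 'n\<close>,
    that is e + e, so additivity in the last argument applies.\<close>
  have double: "christoffel G y w (e * 2) = 2 * christoffel G y w e" for w
    by (simp only: mult_2 mult_2_right bilinear_radd[OF b])
  have 2: "snd (curvature h (t, y) (0, w) ?z ?z) = curvature G y w e e
      - (\<rho>' t) *\<^sub>R w - (f t * f1 t * \<rho> t) *\<^sub>R (G y w e *\<^sub>R e)" for w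
  proof -
    have "snd (curvature h (t, y) (0, w) ?z ?z) = curvature G y w e e
      + (f t * f1 t * \<rho> t * G y e e - (\<rho> t)\<^sup>2 - \<rho>' t) *\<^sub>R w - (f t * f1 t * \<rho> t) *\<^sub>R (G y w e *\<^sub>R e)"
      unfolding curvature_def dd_christoffel_h[OF t y] christoffel_h[OF t y]
      by (simp add: bs gs dz dl double christoffel_sym[OF y, of e w] power2_eq_square algebra_simps)
    then show ?thesis unfolding r2 by simp
  qed
  have lG: "linear (\<lambda>w. G y w e)" using G_bil[OF y] by (simp add: bilinear_def)
  have "ricci h (t, y) ?z ?z = f2 t / f t + (ricci G y e e - \<rho>' t * real CARD('n) - f t * f1 t * \<rho> t * G y e e)"
    unfolding ricci_def endo_trace_prod 1 2 endo_trace_diff endo_trace_scaleR endo_trace_rank_one[OF lG] endo_trace_id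
    by simp
  then show ?thesis unfolding r2 by (simp add: \<rho>'_def diff_divide_distrib algebra_simps)
qed

text \<open>Any nonzero fiber vector, rescaled to length 1/f, completes \<partial>_t to a null
  vector. Flatness of the fiber leaves only -(n - 1) \<rho>', where n - 1 is positive.\<close>

lemma null_convergence_imp:
  assumes t: "t \<in> I" and y: "y \<in> W" and n: "CARD('n) \<ge> 2" and flat: "\<And>u. ricci G y u u = 0"
    and ncc: "\<And>z. h (t, y) z z = 0 \<Longrightarrow> ricci h (t, y) z z \<ge> 0"
  shows "\<rho>' t \<le> 0"
proof -
  obtain u :: "real ^ 'n" where u: "u \<noteq> 0"
    using axis_eq_0_iff[of _ "1::real"] zero_neq_one by blast
  have p: "G y u u > 0" "f t > 0" using G_pos[OF y u] f_pos[OF t] by auto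
  define e where "e = (1 / (f t * sqrt (G y u u))) *\<^sub>R u"
  have e: "(f t)\<^sup>2 * G y e e = 1"
    using p by (simp add: e_def bilinear_lmul[OF G_bil[OF y]] bilinear_rmul[OF G_bil[OF y]] field_simps power2_eq_square)
  have "ricci h (t, y) (1, e) (1, e) \<ge> 0"
    by (rule ncc) (simp add: h_def e)
  then have "(real CARD('n) - 1) * \<rho>' t \<le> 0"
    unfolding ricci_h_null[OF t y e] flat by simp
  then show ?thesis using n by (simp add: mult_le_0_iff)
qed

end

section \<open>Hypersurfaces in a warped product\<close>

lemma Ck_on_cong:
  assumes "open S" "\<And>x. x \<in> S \<Longrightarrow> f x = g x" "Ck_on k S f"
  shows "Ck_on k S g"
  using assms(2,3)
proof (induction k arbitrary: f g)
  case 0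
  then show ?case using continuous_on_cong by simp
next
  case (Suc k)
  have "g differentiable (at x)" if "x \<in> S" for x
    by (rule differentiable_transform_open[where f = f, OF _ assms(1) that]) (use Suc.prems that in auto)
  moreover have "Ck_on k S (\<lambda>x. dd g x u)" for u
  proof (rule Suc.IH)
    show "Ck_on k S (\<lambda>x. dd f x u)" using Suc.prems by simp
    show "dd f x u = dd g x u" if "x \<in> S" for x
      by (rule fun_cong[where x = u], rule dd_cong_open[OF _ assms(1) that]) (use Suc.prems that in auto)
  qed
  ultimately show ?case by simp
qed

lemma dd_bounded_linear:
  assumes L: "bounded_linear L" and f: "f differentiable (at x)"
  shows "(\<lambda>x. L (f x)) differentiable (at x)" "dd (\<lambda>x. L (f x)) x u = L (dd f x u)"
proof -
  have "((\<lambda>x. L (f x)) has_derivative (\<lambda>u. L (dd f x u))) (at x)"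
    by (rule bounded_linear.has_derivative[OF L dd_has_derivative[OF f]])
  then show "(\<lambda>x. L (f x)) differentiable (at x)" "dd (\<lambda>x. L (f x)) x u = L (dd f x u)"
    using dd_eqI unfolding differentiable_def by blast+
qed

lemma smooth_on_bounded_linear:
  assumes L: "bounded_linear L" and S: "open S" and f: "smooth_on S f"
  shows "smooth_on S (\<lambda>x. L (f x))"
proof -
  have "Ck_on k S (\<lambda>x. L (f x))" if "smooth_on S f" for k
    using that
  proof (induction k arbitrary: f)
    case 0
    then have "continuous_on S f" by (metis smooth_on_def Ck_on.simps(1))
    then show ?case using bounded_linear.continuous_on[OF L] by simp
  next
    case (Suc k)
    note d = smooth_on_differentiable[OF Suc.prems]
    have "Ck_on k S (\<lambda>x. dd (\<lambda>x. L (f x)) x u)" for u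
      by (rule Ck_on_cong[OF S _ Suc.IH[OF smooth_on_dd[OF Suc.prems]]])
         (simp add: dd_bounded_linear(2)[OF L d])
    then show ?case using dd_bounded_linear(1)[OF L d] by simp
  qed
  then show ?thesis using f unfolding smooth_on_def by blast
qed

text \<open>One pair of charts: \<open>P\<close> and \<open>N\<close> are the coordinate expressions
  of the immersion and of its unit normal.\<close>

locale warped_hypersurface = warped_product W G I f f1 f2
  for W :: "(real ^ 'n) set" and G and I :: "real set" and f f1 f2 :: "real \<Rightarrow> real" +
  fixes U :: "(real ^ 'n) set" and P N :: "real ^ 'n \<Rightarrow> real \<times> (real ^ 'n)"
  assumes open_U: "open U" and P_smooth: "smooth_on U P" and N_smooth: "smooth_on U N"
    and P_range: "x \<in> U \<Longrightarrow> P x \<in> I \<times> W"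
    and N_unit: "x \<in> U \<Longrightarrow> h (P x) (N x) (N x) = -1"
    and N_normal: "x \<in> U \<Longrightarrow> h (P x) (N x) (dd P x u) = 0"
    and N_future: "x \<in> U \<Longrightarrow> fst (N x) > 0"
    and spacelike: "x \<in> U \<Longrightarrow> u \<noteq> 0 \<Longrightarrow> h (P x) (dd P x u) (dd P x u) > 0"
begin

definition "\<tau> x = fst (P x)"
definition "\<pi> x = snd (P x)"
definition "a x = fst (N x)"
definition "\<nu> x = snd (N x)"
text \<open>A pointwise inverse, justified by \<open>injQ\<close> and \<open>surjQ\<close>
  below.\<close>

definition "V x = inv (dd \<pi> x) (\<nu> x)"
definition "\<gamma> x u v = G (\<pi> x) (dd \<pi> x u) (dd \<pi> x v)"
text \<open>The pulled back Levi-Civita connection: d\<pi> carries \<open>\<Gamma> x u v\<close> to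
  the covariant derivative along \<pi>, in direction u, of the field d\<pi> v with v
  constant.\<close>

definition "\<Gamma> x u v = inv (dd \<pi> x) (dd (\<lambda>y. dd \<pi> y v) x u + christoffel G (\<pi> x) (dd \<pi> x u) (dd \<pi> x v))"

lemma smooth: "smooth_on U \<tau>" "smooth_on U \<pi>" "smooth_on U a" "smooth_on U \<nu>"
  unfolding \<tau>_def[abs_def] \<pi>_def[abs_def] a_def[abs_def] \<nu>_def[abs_def]
  by (rule smooth_on_bounded_linear[OF bounded_linear_fst open_U P_smooth]
      smooth_on_bounded_linear[OF bounded_linear_snd open_U P_smooth]
      smooth_on_bounded_linear[OF bounded_linear_fst open_U N_smooth]
      smooth_on_bounded_linear[OF bounded_linear_snd open_U N_smooth])+

lemmas diff = smooth[THEN smooth_on_differentiable]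
lemmas diff2 = smooth(1,2)[THEN smooth_on_dd, THEN smooth_on_differentiable]
lemmas diff3 = smooth(2)[THEN smooth_on_dd, THEN smooth_on_dd, THEN smooth_on_differentiable]

lemma \<tau>_mem: "x \<in> U \<Longrightarrow> \<tau> x \<in> I" and \<pi>_mem: "x \<in> U \<Longrightarrow> \<pi> x \<in> W"
  using P_range by (auto simp: \<tau>_def \<pi>_def mem_Times_iff)

lemma dd_P: "x \<in> U \<Longrightarrow> dd P x u = (dd \<tau> x u, dd \<pi> x u)"
  using dd_bounded_linear(2)[OF bounded_linear_fst smooth_on_differentiable[OF P_smooth]]
    dd_bounded_linear(2)[OF bounded_linear_snd smooth_on_differentiable[OF P_smooth]]
  by (simp add: \<tau>_def[abs_def] \<pi>_def[abs_def] prod_eq_iff)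

lemma dd_N: "x \<in> U \<Longrightarrow> dd N x u = (dd a x u, dd \<nu> x u)"
  using dd_bounded_linear(2)[OF bounded_linear_fst smooth_on_differentiable[OF N_smooth]]
    dd_bounded_linear(2)[OF bounded_linear_snd smooth_on_differentiable[OF N_smooth]]
  by (simp add: a_def[abs_def] \<nu>_def[abs_def] prod_eq_iff)

lemma spacelike': "x \<in> U \<Longrightarrow> u \<noteq> 0 \<Longrightarrow> (f (\<tau> x))\<^sup>2 * \<gamma> x u u - (dd \<tau> x u)\<^sup>2 > 0"
  using spacelike[of x u] by (simp add: h_def dd_P \<gamma>_def power2_eq_square flip: \<tau>_def \<pi>_def)

context
  fixes x assumes x: "x \<in> U"
begin

lemmas h\<pi> = dd_has_derivative[OF diff(2)[OF x]]
lemmas linQ = linear_dd[OF diff(2)[OF x]]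
lemmas hQ = dd_has_derivative[OF diff2(2)[OF x]]
lemmas Gb = G_bil[OF \<pi>_mem[OF x]]
lemmas Cb = christoffel_bil[OF \<pi>_mem[OF x]]
lemmas C_lin_simps = bilinear_ladd[OF Cb] bilinear_radd[OF Cb] bilinear_lmul[OF Cb] bilinear_rmul[OF Cb]
lemmas G_lin_simps = bilinear_ladd[OF Gb] bilinear_radd[OF Gb] bilinear_lmul[OF Gb] bilinear_rmul[OF Gb]

text \<open>A vector killed by d\<pi> is mapped by the immersion to a multiple of \<partial>_t,
  which is not spacelike.\<close>

lemma injQ: "inj (dd \<pi> x)"
proof -
  have "u = 0" if "dd \<pi> x u = 0" for u
  proof (rule ccontr)
    assume "u \<noteq> 0"
    from spacelike'[OF x this] have "- (dd \<tau> x u)\<^sup>2 > 0"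
      by (simp add: \<gamma>_def that bilinear_lzero[OF Gb])
    then show False by (simp add: not_less)
  qed
  then show ?thesis using linear_injective_0[OF linQ] by blast
qed

lemma surjQ: "surj (dd \<pi> x)"
  by (rule linear_inj_imp_surj[OF linQ injQ])

lemma Q_eqI: "dd \<pi> x u = dd \<pi> x v \<Longrightarrow> u = v"
  using injQ by (simp add: inj_eq)

lemma QV: "dd \<pi> x (V x) = \<nu> x"
  by (simp add: V_def surj_f_inv_f[OF surjQ])

lemma Q\<Gamma>: "dd \<pi> x (\<Gamma> x u v) = dd (\<lambda>y. dd \<pi> y v) x u + christoffel G (\<pi> x) (dd \<pi> x u) (dd \<pi> x v)"
  by (simp add: \<Gamma>_def surj_f_inv_f[OF surjQ])

lemma hess_\<pi>_sym: "dd (\<lambda>y. dd \<pi> y v) x u = dd (\<lambda>y. dd \<pi> y u) x v"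
  by (rule dd_commute[OF open_U x diff(2) diff2(2)[OF x]])

lemma \<Gamma>_sym: "\<Gamma> x u v = \<Gamma> x v u"
  by (rule Q_eqI) (simp add: Q\<Gamma> hess_\<pi>_sym[of v u] christoffel_sym[OF \<pi>_mem[OF x], of _ "dd \<pi> x v"])

lemma linear_\<Gamma>: "linear (\<lambda>u. \<Gamma> x u v)"
  by (rule linearI; rule Q_eqI)
    (simp_all add: Q\<Gamma> linear_add[OF linQ] linear_cmul[OF linQ] C_lin_simps
      linear_add[OF linear_dd[OF diff2(2)[OF x]]] linear_cmul[OF linear_dd[OF diff2(2)[OF x]]] algebra_simps)

lemma \<Gamma>_bil: "bilinear (\<Gamma> x)"
proof -
  have "linear (\<Gamma> x u)" for u
    using linear_\<Gamma>[of u] by (simp add: \<Gamma>_sym[of _ u])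
  then show ?thesis using linear_\<Gamma> unfolding bilinear_def by blast
qed

lemma \<gamma>_bil: "bilinear (\<gamma> x)"
  by (auto simp: bilinear_def linear_iff \<gamma>_def linear_add[OF linQ] linear_cmul[OF linQ] G_lin_simps)

lemma \<gamma>_sym: "\<gamma> x u v = \<gamma> x v u"
  unfolding \<gamma>_def by (rule G_sym[OF \<pi>_mem[OF x]])

lemma has_derivative_christoffel:
  assumes "(\<alpha> has_derivative \<alpha>') (at x)" "(\<delta> has_derivative \<delta>') (at x)"
  shows "((\<lambda>y. christoffel G (\<pi> y) (\<alpha> y) (\<delta> y)) has_derivative
    (\<lambda>z. dd (\<lambda>y. christoffel G y (\<alpha> x) (\<delta> x)) (\<pi> x) (dd \<pi> x z)
      + christoffel G (\<pi> x) (\<alpha>' z) (\<delta> x) + christoffel G (\<pi> x) (\<alpha> x) (\<delta>' z))) (at x)"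
  by (rule has_derivative_bilinear_family[where p = \<pi>, OF open_W \<pi>_mem[OF x] christoffel_bil
        christoffel_diff[OF \<pi>_mem[OF x]] h\<pi> assms])

lemma has_derivative_\<gamma>: "((\<lambda>y. \<gamma> y v w) has_derivative
    (\<lambda>z. dd (\<lambda>y. G y (dd \<pi> x v) (dd \<pi> x w)) (\<pi> x) (dd \<pi> x z)
      + G (\<pi> x) (dd (\<lambda>y. dd \<pi> y v) x z) (dd \<pi> x w) + G (\<pi> x) (dd \<pi> x v) (dd (\<lambda>y. dd \<pi> y w) x z))) (at x)"
  unfolding \<gamma>_def
  by (rule has_derivative_bilinear_family[where p = \<pi>, OF open_W \<pi>_mem[OF x] G_bil
        G_diff[OF \<pi>_mem[OF x]] h\<pi> hQ hQ])

lemma \<gamma>_diff: "(\<lambda>y. \<gamma> y v w) differentiable (at x)"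
  using has_derivative_\<gamma> unfolding differentiable_def by blast

lemma compat: "dd (\<lambda>y. \<gamma> y v w) x u = \<gamma> x (\<Gamma> x u v) w + \<gamma> x v (\<Gamma> x u w)"
  unfolding dd_eqI[OF has_derivative_\<gamma>] metric_compatible[OF \<pi>_mem[OF x]]
  by (simp add: \<gamma>_def Q\<Gamma> G_lin_simps)

lemma differentiable_solution:
  assumes "m differentiable (at x)" "\<And>y. y \<in> U \<Longrightarrow> dd \<pi> y (w y) = m y"
  shows "w differentiable (at x)"
  by (rule differentiable_linear_system[OF open_U x linear_dd[OF diff(2)] _ diff2(2)[OF x] assms])
     (auto intro: warped_hypersurface.injQ[OF warped_hypersurface_axioms])

end

section \<open>Regularity of the pulled back data and the shape operator\<close>

lemma \<Gamma>_diff: "x \<in> U \<Longrightarrow> (\<lambda>y. \<Gamma> y u v) differentiable (at x)"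
  by (rule differentiable_solution[OF _ _ Q\<Gamma>])
     (auto intro!: differentiable_add diff3 differentiableI[OF has_derivative_christoffel[OF _ hQ hQ]])

lemma V_diff: "x \<in> U \<Longrightarrow> V differentiable (at x)"
  by (rule differentiable_solution[where m = \<nu>]) (auto intro: diff simp: QV)

lemma dd_\<nu>:
  assumes x: "x \<in> U"
  shows "dd \<nu> x u = dd (\<lambda>y. dd \<pi> y (V x)) x u + dd \<pi> x (dd V x u)"
proof (rule dd_eqI)
  show "(\<nu> has_derivative (\<lambda>u. dd (\<lambda>y. dd \<pi> y (V x)) x u + dd \<pi> x (dd V x u))) (at x)"
    by (rule has_derivative_transform_within_open[OF has_derivative_linear_family_id[OF open_U x linear_dd[OF diff(2)] diff2(2)[OF x]
          dd_has_derivative[OF V_diff[OF x]]] open_U x])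
      (simp_all add: QV)
qed

text \<open>d\<pi> carries \<nabla>V to the covariant derivative of \<open>\<nu>\<close> along
  \<pi>. The right-hand side contains no derivative of V.\<close>

lemma QB:
  assumes x: "x \<in> U"
  shows "dd \<pi> x (dd V x u + \<Gamma> x u (V x)) = dd \<nu> x u + christoffel G (\<pi> x) (dd \<pi> x u) (\<nu> x)"
  by (simp add: linear_add[OF linQ[OF x]] Q\<Gamma>[OF x] dd_\<nu>[OF x] QV[OF x])

text \<open>Cramer's rule for \<open>V\<close> gives only one derivative. For the second,
  \<open>QB\<close> exhibits \<nabla>V as the solution of a linear system with differentiable data,
  and the connection term, already known to be differentiable, is subtracted.\<close>

lemma dV_diff:
  assumes x: "x \<in> U"
  shows "(\<lambda>y. dd V y u) differentiable (at x)"
proof -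
  have "(\<lambda>y. dd \<nu> y u + christoffel G (\<pi> y) (dd \<pi> y u) (\<nu> y)) differentiable (at x)"
    by (intro differentiable_add smooth_on_differentiable[OF smooth_on_dd[OF smooth(4)] x]
        differentiableI[OF has_derivative_christoffel[OF x hQ[OF x] dd_has_derivative[OF diff(4)[OF x]]]])
  then have "(\<lambda>y. dd V y u + \<Gamma> y u (V y)) differentiable (at x)"
    by (rule differentiable_solution[OF x]) (rule QB)
  moreover have "(\<lambda>y. \<Gamma> y u (V y)) differentiable (at x)"
    by (rule differentiableI[OF has_derivative_bilinear_family_id[OF open_U x \<Gamma>_bil \<Gamma>_diff[OF x] has_derivative_const
          dd_has_derivative[OF V_diff[OF x]]]])
  ultimately have "(\<lambda>y. (dd V y u + \<Gamma> y u (V y)) - \<Gamma> y u (V y)) differentiable (at x)"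
    by (rule differentiable_diff)
  then show ?thesis by simp
qed

sublocale graph: warped_graph U \<gamma> \<Gamma> \<tau> a V f f1 f2
proof
  fix x u assume x: "x \<in> U"
  show "(f (\<tau> x))\<^sup>2 * \<gamma> x (V x) (V x) = (a x)\<^sup>2 - 1"
    using N_unit[OF x] by (simp add: h_def \<gamma>_def QV[OF x] power2_eq_square flip: \<tau>_def \<pi>_def a_def \<nu>_def)
  show "(f (\<tau> x))\<^sup>2 * \<gamma> x (V x) u = a x * dd \<tau> x u"
    using N_normal[OF x, of u] by (simp add: h_def \<gamma>_def QV[OF x] dd_P[OF x] flip: \<tau>_def \<pi>_def a_def \<nu>_def)
  show "0 < a x" using N_future[OF x] by (simp add: a_def)
qed ((rule open_U | erule \<gamma>_bil \<gamma>_sym \<gamma>_diff \<Gamma>_bil \<Gamma>_sym \<Gamma>_diff compat V_diff dV_diff diff diff2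
    | (rule f_deriv f1_deriv f_pos, erule \<tau>_mem) | (rule spacelike'; assumption))+)

text \<open>Time and fiber components are compared separately. The fiber part is the definition of
  \<open>A\<close> pushed forward by \<open>QB\<close>; the time part is \<open>d\<tau>A\<close>,
  once \<open>normal\<close> has turned the warping term into \<rho> a d\<tau>.\<close>

lemma dd_P_A:
  assumes x: "x \<in> U"
  shows "dd P x (graph.A x u) = - covariant_derivative_along h P N x u"
proof -
  have c: "covariant_derivative_along h P N x u = (dd a x u + f (\<tau> x) * f1 (\<tau> x) * G (\<pi> x) (dd \<pi> x u) (\<nu> x),
      dd \<nu> x u + (christoffel G (\<pi> x) (dd \<pi> x u) (\<nu> x) + \<rho> (\<tau> x) *\<^sub>R (dd \<tau> x u *\<^sub>R \<nu> x + a x *\<^sub>R dd \<pi> x u)))"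
    unfolding covariant_derivative_along_def
    using christoffel_h[OF \<tau>_mem[OF x] \<pi>_mem[OF x], of "dd P x u" "N x"]
    by (simp add: dd_P[OF x] dd_N[OF x] \<tau>_def \<pi>_def a_def \<nu>_def)
  have \<rho>: "graph.\<rho> x = \<rho> (\<tau> x)" by (simp add: graph.\<rho>_def \<rho>_def)
  have "f (\<tau> x) * f1 (\<tau> x) * G (\<pi> x) (dd \<pi> x u) (\<nu> x) = \<rho> (\<tau> x) * ((f (\<tau> x))\<^sup>2 * \<gamma> x (V x) u)"
    using f_pos[OF \<tau>_mem[OF x]] by (simp add: \<rho>_def \<gamma>_def QV[OF x] G_sym[OF \<pi>_mem[OF x], of "\<nu> x"] power2_eq_square)
  then have 1: "f (\<tau> x) * f1 (\<tau> x) * G (\<pi> x) (dd \<pi> x u) (\<nu> x) = \<rho> (\<tau> x) * (a x * dd \<tau> x u)"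
    unfolding graph.normal[OF x] .
  have "dd \<pi> x (graph.A x u) = - dd \<pi> x (graph.B x u) - \<rho> (\<tau> x) *\<^sub>R (dd \<tau> x u *\<^sub>R \<nu> x + a x *\<^sub>R dd \<pi> x u)"
    by (simp add: graph.A_def \<rho> linear_add[OF linQ[OF x]] linear_diff[OF linQ[OF x]] linear_neg[OF linQ[OF x]]
        linear_cmul[OF linQ[OF x]] QV[OF x])
  then show ?thesis
    unfolding dd_P[OF x] c 1 graph.d\<tau>A[OF x] graph.B_def QB[OF x] \<rho> by simp
qed

lemma shape_operator_eq:
  assumes x: "x \<in> U"
  shows "(THE w. dd P x w = - covariant_derivative_along h P N x u) = graph.A x u"
  by (rule the_equality) (simp_all add: dd_P_A[OF x, symmetric] dd_P[OF x], blast dest: Q_eqI[OF x])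

text \<open>Differentiating the equation \<open>Q\<Gamma>\<close> produces third derivatives of
  \<pi>, which cancel by symmetry. The terms with second derivatives cancel against the quadratic
  terms in \<Gamma> or with each other.\<close>

lemma curvature_pullback:
  assumes x: "x \<in> U"
  shows "dd \<pi> x (dd (\<lambda>y. \<Gamma> y v w) x u - dd (\<lambda>y. \<Gamma> y u w) x v + \<Gamma> x u (\<Gamma> x v w) - \<Gamma> x v (\<Gamma> x u w)) =
    curvature G (\<pi> x) (dd \<pi> x u) (dd \<pi> x v) (dd \<pi> x w)"
proof -
  let ?C = "christoffel G (\<pi> x)" and ?Q = "dd \<pi> x" and ?H = "\<lambda>u v. dd (\<lambda>y. dd \<pi> y v) x u"
  have D: "?Q (dd (\<lambda>y. \<Gamma> y v w) x u) = dd (\<lambda>y. dd (\<lambda>y. dd \<pi> y w) y v) x u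
      + (dd (\<lambda>y. christoffel G y (?Q v) (?Q w)) (\<pi> x) (?Q u) + ?C (?H u v) (?Q w) + ?C (?Q v) (?H u w))
      - ?H u (\<Gamma> x v w)" for u v
  proof -
    have 1: "((\<lambda>y. dd \<pi> y (\<Gamma> y v w)) has_derivative (\<lambda>u. ?H u (\<Gamma> x v w) + ?Q (dd (\<lambda>y. \<Gamma> y v w) x u))) (at x)"
      by (rule has_derivative_linear_family_id[OF open_U x linear_dd[OF diff(2)] diff2(2)[OF x] dd_has_derivative[OF \<Gamma>_diff[OF x]]])
    have "((\<lambda>y. dd (\<lambda>y. dd \<pi> y w) y v + christoffel G (\<pi> y) (dd \<pi> y v) (dd \<pi> y w)) has_derivative
      (\<lambda>u. dd (\<lambda>y. dd (\<lambda>y. dd \<pi> y w) y v) x u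
      + (dd (\<lambda>y. christoffel G y (?Q v) (?Q w)) (\<pi> x) (?Q u) + ?C (?H u v) (?Q w) + ?C (?Q v) (?H u w)))) (at x)"
      by (intro has_derivative_add dd_has_derivative diff3 x has_derivative_christoffel hQ)
    then have 2: "((\<lambda>y. dd \<pi> y (\<Gamma> y v w)) has_derivative
      (\<lambda>u. dd (\<lambda>y. dd (\<lambda>y. dd \<pi> y w) y v) x u
      + (dd (\<lambda>y. christoffel G y (?Q v) (?Q w)) (\<pi> x) (?Q u) + ?C (?H u v) (?Q w) + ?C (?Q v) (?H u w)))) (at x)"
      by (rule has_derivative_transform_within_open[OF _ open_U x]) (simp add: Q\<Gamma>)
    show ?thesis
      using fun_cong[OF has_derivative_unique[OF 1 2], of u] by (simp add: algebra_simps)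
  qed
  have c: "dd (\<lambda>y. dd (\<lambda>y. dd \<pi> y w) y v) x u = dd (\<lambda>y. dd (\<lambda>y. dd \<pi> y w) y u) x v"
    by (rule dd_commute[OF open_U x diff2(2) diff3[OF x]])
  show ?thesis
    unfolding curvature_def
    by (simp add: linear_add[OF linQ[OF x]] linear_diff[OF linQ[OF x]] D Q\<Gamma>[OF x] C_lin_simps[OF x] c
        hess_\<pi>_sym[OF x, of v u])
qed

text \<open>By \<open>curvature_pullback\<close> the operator under the trace is the fiber curvature
  conjugated by d\<pi>.\<close>

lemma ricci_pullback:
  assumes x: "x \<in> U"
  shows "endo_trace (\<lambda>u. dd (\<lambda>y. \<Gamma> y v w) x u - dd (\<lambda>y. \<Gamma> y u w) x v + \<Gamma> x u (\<Gamma> x v w) - \<Gamma> x v (\<Gamma> x u w)) =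
    ricci G (\<pi> x) (dd \<pi> x v) (dd \<pi> x w)"
proof -
  let ?Q = "dd \<pi> x" and ?C = "\<lambda>u. curvature G (\<pi> x) u (dd \<pi> x v) (dd \<pi> x w)"
  have inv: "linear (inv ?Q)" 
    by (rule linearI; rule Q_eqI[OF x])
      (simp_all add: surj_f_inv_f[OF surjQ[OF x]] linear_add[OF linQ[OF x]] linear_cmul[OF linQ[OF x]])
  have "linear (\<lambda>u. ?C (?Q u))"
    using linear_compose[OF linQ[OF x] curvature_linear[OF \<pi>_mem[OF x]]] by (simp add: o_def)
  note tr = endo_trace_compose_commute[OF inv this]
  have "(\<lambda>u. dd (\<lambda>y. \<Gamma> y v w) x u - dd (\<lambda>y. \<Gamma> y u w) x v + \<Gamma> x u (\<Gamma> x v w) - \<Gamma> x v (\<Gamma> x u w)) =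
      (\<lambda>u. inv ?Q (?C (?Q u)))"
    by (simp add: curvature_pullback[OF x, symmetric] inv_f_f[OF injQ[OF x]])
  then show ?thesis
    unfolding ricci_def using tr by (simp add: surj_f_inv_f[OF surjQ[OF x]])
qed

theorem laplacian_inequality_maximal:
  assumes x: "x \<in> U" and n: "CARD('n) \<ge> 2"
    and flat: "\<And>v w. ricci G (\<pi> x) v w = 0"
    and ncc: "\<And>z. h (P x) z z = 0 \<Longrightarrow> ricci h (P x) z z \<ge> 0"
    and maximal: "\<And>y. y \<in> U \<Longrightarrow> endo_trace (\<lambda>u. THE w. dd P y w = - covariant_derivative_along h P N y u) = 0"
    and k: "\<And>y u v. y \<in> U \<Longrightarrow> k y u v = h (P y) (dd P y u) (dd P y v)"
    and \<phi>: "\<And>y. y \<in> U \<Longrightarrow> \<phi> y = (fst (N y))\<^sup>2 - 1"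
  shows "1/2 * divergence k (gradient k \<phi>) x \<ge>
    ((real CARD('n) + 1) * (f1 (fst (P x)))\<^sup>2 / (f (fst (P x)))\<^sup>2 - real CARD('n) * f2 (fst (P x)) / f (fst (P x)))
      * ((fst (N x))\<^sup>2 - 1)\<^sup>2"
proof -
  have "P x = (\<tau> x, \<pi> x)" by (simp add: \<tau>_def \<pi>_def)
  then have "graph.\<rho>' x \<le> 0"
    using null_convergence_imp[OF \<tau>_mem[OF x] \<pi>_mem[OF x] n flat] ncc
    by (simp add: graph.\<rho>'_def graph.\<rho>_def \<rho>'_def \<rho>_def)
  moreover have "endo_trace (graph.A y) = 0" if "y \<in> U" for y
    using maximal[OF that] by (simp add: shape_operator_eq[OF that])
  moreover have "k y u v = graph.g y u v" if "y \<in> U" for y u v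
    unfolding k[OF that] graph.g_def by (simp add: h_def dd_P[OF that] \<gamma>_def \<tau>_def \<pi>_def)
  ultimately show ?thesis
    using graph.laplacian_inequality[OF x, of k \<phi>] ricci_pullback[OF x, of "V x" "V x"] flat n \<phi>
    by (simp add: \<tau>_def a_def)
qed

end

section \<open>Charts\<close>

lemma smooth_manifold_chart:
  assumes M: "smooth_manifold M" and j: "j \<in> charts M"
  shows "openin (pts M) (chart_dom M j)" "open (img M j)"
    and "q \<in> chart_dom M j \<Longrightarrow> param M j (coord M j q) = q"
    and "openin (pts M) D \<Longrightarrow> D \<subseteq> chart_dom M j \<Longrightarrow> open (coord M j ` D)"
proof -
  show o: "openin (pts M) (chart_dom M j)" and i: "open (img M j)"
    using M j unfolding smooth_manifold_def by auto
  have hom: "homeomorphic_map (subtopology (pts M) (chart_dom M j)) (top_of_set (img M j)) (coord M j)"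
    using M j unfolding smooth_manifold_def by auto
  have "inj_on (coord M j) (chart_dom M j)"
    using homeomorphic_imp_injective_map[OF hom] openin_subset[OF o] by (simp add: inf.absorb2)
  then show "q \<in> chart_dom M j \<Longrightarrow> param M j (coord M j q) = q"
    unfolding param_def by (rule inv_into_f_f)
  show "open (coord M j ` D)" if D: "openin (pts M) D" "D \<subseteq> chart_dom M j"
  proof -
    have "openin (subtopology (pts M) (chart_dom M j)) D"
      using D o by (simp add: openin_open_subtopology)
    then have "openin (top_of_set (img M j)) (coord M j ` D)"
      using homeomorphic_imp_open_map[OF hom] unfolding open_map_def by blast
    then show ?thesis using i by (simp add: openin_open_eq)
  qed
qed

text \<open>\<open>smooth_on\<close> speaks of Frechet derivatives; \<open>dd f s 1\<close> is
  \<open>deriv f s\<close>, so differentiability passes on to \<open>deriv f\<close>.\<close>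

lemma smooth_on_real_deriv:
  fixes f :: "real \<Rightarrow> real"
  assumes I: "open I" "t \<in> I" and f: "smooth_on I f"
  shows "(f has_real_derivative deriv f t) (at t)"
    and "(deriv f has_real_derivative deriv (deriv f) t) (at t)"
proof -
  have d: "(f has_real_derivative deriv f s) (at s)" if "s \<in> I" for s
    using smooth_on_differentiable[OF f that] real_differentiable_def DERIV_imp_deriv by metis
  then show "(f has_real_derivative deriv f t) (at t)" using I by blast
  have "dd f s 1 = deriv f s" if "s \<in> I" for s
    using dd_eqI[OF d[OF that, unfolded has_field_derivative_def]] by simp
  then have "deriv f differentiable (at t)"
    using differentiable_transform_open[OF smooth_on_differentiable[OF smooth_on_dd[OF f] I(2)] I] by blast
  then show "(deriv f has_real_derivative deriv (deriv f) t) (at t)"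
    using real_differentiable_def DERIV_imp_deriv by metis
qed

theorem lemma1:
  fixes F :: "('i, 'p, real ^ 'n) manifold" and gF :: "('i, real ^ 'n) tensor2"
    and I :: "real set" and f :: "real \<Rightarrow> real"
    and M :: "('j, 'm, real ^ 'n) manifold" and gM :: "('j, real ^ 'n) tensor2"
    and \<psi> :: "'m \<Rightarrow> real \<times> 'p" and N :: "'i \<Rightarrow> 'm \<Rightarrow> real \<times> (real ^ 'n)"
    and \<phi> :: "'m \<Rightarrow> real"
  defines "S \<equiv> interval_product I F" and "h \<equiv> grw_metric f gF"
  assumes "CARD('n) \<ge> 2"
    and "smooth_manifold F" and "connected_space (pts F)" and "riemannian_metric F gF"
    and "open I" and "is_interval I"
    and "smooth_on I f" and "\<And>t. t \<in> I \<Longrightarrow> f t > 0"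
    and "ricci_flat F gF"
    and "null_convergence_condition S h"
    and "smooth_manifold M"
    and "spacelike_immersion M S h \<psi> gM"
    and "unit_timelike_normal M S h \<psi> N" and "future_directed M S h \<psi> N"
    and "maximal M S h \<psi> N"
    and "hyperbolic_angle M S h \<psi> N \<phi>"
  shows "\<forall>j\<in>charts M. \<forall>p\<in>chart_dom M j.
    (let n = real CARD('n); \<tau> = fst (\<psi> p) in
      1/2 * laplacian M gM j (\<lambda>q. (sinh (\<phi> q))\<^sup>2) p
        \<ge> ((n + 1) * (deriv f \<tau>)\<^sup>2 / (f \<tau>)\<^sup>2 - n * deriv (deriv f) \<tau> / f \<tau>) * (sinh (\<phi> p)) ^ 4)"
proof (intro ballI)
  fix j p assume j: "j \<in> charts M" and p: "p \<in> chart_dom M j"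
  note F = assms(4) and gF = assms(6) and M = assms(13)
  have imm: "immersion M S \<psi>" and ind: "induced_metric M S h \<psi> gM" and gM: "riemannian_metric M gM"
    using assms(14) unfolding spacelike_immersion_def by auto
  have S: "chart_dom S i = I \<times> chart_dom F i" "charts S = charts F"
    "coord S i q = (fst q, coord F i (snd q))" for i q
    by (auto simp: S_def interval_product_def split: prod.split)
  have pts_S: "pts S = prod_topology (top_of_set I) (pts F)" by (simp add: S_def interval_product_def)
  have cont: "continuous_map (pts M) (pts S) \<psi>" using imm unfolding immersion_def by auto
  have domM: "chart_dom M j \<subseteq> topspace (pts M)"
    using smooth_manifold_chart(1)[OF M j] openin_subset by blast
  have "\<psi> p \<in> I \<times> topspace (pts F)"
    using continuous_map_image_subset_topspace[OF cont] p domM unfolding pts_S by auto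
  moreover have "(\<Union>i\<in>charts F. chart_dom F i) = topspace (pts F)"
    using F unfolding smooth_manifold_def by blast
  ultimately obtain i where i: "i \<in> charts F" "\<psi> p \<in> chart_dom S i"
    unfolding S mem_Times_iff by blast
  \<comment> \<open>The image of chart j need not lie over a single fiber chart, so the local
    argument is made on the part that \<psi> sends into chart i. It is open and contains the point
    in question, and the Laplacian at that point depends on nothing else.\<close>
  define U where "U = local_dom M S \<psi> j i"
  define P where "P = local_rep M S \<psi> j i"
  define N' where "N' = N i \<circ> param M j"
  define D where "D = {q \<in> chart_dom M j. \<psi> q \<in> chart_dom S i}"
  have iS: "i \<in> charts S" using i S by simp
  have U_eq: "U = coord M j ` D" by (simp add: U_def D_def local_dom_def)
  have parD: "param M j (coord M j q) = q" if "q \<in> D" for q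
    using smooth_manifold_chart(3)[OF M j] that by (simp add: D_def)
  have PD: "P (coord M j q) = coord S i (\<psi> q)" if "q \<in> D" for q
    by (simp add: P_def local_rep_def parD[OF that])
  have imgS: "P x \<in> img S i" and P_mem: "P x \<in> I \<times> img F i" if x: "x \<in> U" for x
  proof -
    obtain q where "q \<in> D" "x = coord M j q" using x U_eq by auto
    then have q: "P x = coord S i (\<psi> q)" "\<psi> q \<in> chart_dom S i" using PD by (auto simp: D_def)
    then show "P x \<in> img S i" by (simp add: img_def)
    show "P x \<in> I \<times> img F i" using q by (auto simp: S img_def)
  qed
  have "openin (pts S) (chart_dom S i)"
    unfolding pts_S S using smooth_manifold_chart(1)[OF F i(1)] by (simp add: openin_prod_Times_iff)
  then have "openin (pts M) {q \<in> topspace (pts M). \<psi> q \<in> chart_dom S i}"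
    using openin_continuous_map_preimage[OF cont] by blast
  then have "openin (pts M) (chart_dom M j \<inter> {q \<in> topspace (pts M). \<psi> q \<in> chart_dom S i})"
    using smooth_manifold_chart(1)[OF M j] by blast
  moreover have "chart_dom M j \<inter> {q \<in> topspace (pts M). \<psi> q \<in> chart_dom S i} = D"
    using domM by (auto simp: D_def)
  ultimately have open_U: "open U"
    unfolding U_eq using smooth_manifold_chart(4)[OF M j] by (auto simp: D_def)
  interpret W: warped_product "img F i" "gF i" I f "deriv f" "deriv (deriv f)"
    using smooth_manifold_chart(2)[OF F i(1)] gF i(1) assms(7,10) smooth_on_real_deriv[OF assms(7) _ assms(9)]
    unfolding riemannian_metric_def smooth_tensor2_def by unfold_locales auto
  have hW: "h i = W.h"
    by (auto simp: fun_eq_iff h_def grw_metric_def W.h_def)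
  \<comment> \<open>Pairing with \<partial>_t sees only the time component, up to sign. Hence a is
    cosh \<phi>, which gives its positivity and identifies a^2 - 1 with sinh^2 \<phi>.\<close>
  have N_dt: "fst (N' x) = cosh (\<phi> (param M j x))" if x: "x \<in> U" for x
  proof -
    obtain q where q: "q \<in> D" "x = coord M j q" using x U_eq by auto
    then have "cosh (\<phi> q) = - h i (coord S i (\<psi> q)) (N i q) grw_dt"
      using assms(18) iS domM unfolding hyperbolic_angle_def D_def by blast
    moreover have "snd (coord S i (\<psi> q)) \<in> img F i" using P_mem[OF x] PD q by auto
    ultimately show ?thesis
      by (simp add: hW W.h_def grw_dt_def bilinear_rzero[OF W.G_bil] N'_def q parD)
  qed
  have normal: "h i (P x) (N' x) (N' x) = -1" "h i (P x) (N' x) (dd P x u) = 0" if "x \<in> U" for x u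
    using assms(15) j iS that unfolding unit_timelike_normal_def U_def P_def N'_def by auto
  have gM_eq: "gM j x u v = h i (P x) (dd P x u) (dd P x v)" if "x \<in> U" for x u v
    using ind j iS that unfolding induced_metric_def U_def P_def by blast
  interpret X: warped_hypersurface "img F i" "gF i" I f "deriv f" "deriv (deriv f)" U P N'
  proof
    show "smooth_on U P" using imm j iS unfolding immersion_def U_def P_def by blast
    show "smooth_on U N'"
      using assms(15) j iS unfolding unit_timelike_normal_def vector_field_along_def U_def N'_def by blast
    fix x assume x: "x \<in> U"
    show "fst (N' x) > 0" using N_dt[OF x] by simp
    show "W.h (P x) (dd P x u) (dd P x u) > 0" if "u \<noteq> 0" for u
    proof -
      have "x \<in> img M j" using x by (auto simp: U_eq D_def img_def)
      then have "gM j x u u > 0" using gM j that unfolding riemannian_metric_def by blast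
      then show ?thesis using gM_eq[OF x] hW by simp
    qed
  qed (use open_U P_mem normal hW in auto)
  define x where "x = coord M j p"
  have pD: "p \<in> D" using p i by (simp add: D_def)
  then have x: "x \<in> U" by (simp add: x_def U_eq)
  have Px: "fst (P x) = fst (\<psi> p)" using PD[OF pD] by (simp add: x_def S)
  have sinh: "(sinh (\<phi> (param M j y)))\<^sup>2 = (fst (N' y))\<^sup>2 - 1" if "y \<in> U" for y
    using N_dt[OF that] cosh_square_eq[of "\<phi> (param M j y)"] by simp
  have flat: "ricci (gF i) (X.\<pi> x) v w = 0" for v w
    using assms(11) i(1) X.\<pi>_mem[OF x] unfolding ricci_flat_def by blast
  have ncc: "ricci W.h (P x) z z \<ge> 0" if "W.h (P x) z z = 0" for z
    using assms(12) iS imgS[OF x] that unfolding null_convergence_condition_def hW[symmetric] by blast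
  have max: "endo_trace (\<lambda>u. THE w. dd P y w = - covariant_derivative_along W.h P N' y u) = 0" if "y \<in> U" for y
  proof -
    have "mean_curvature M S h \<psi> N j i y = 0"
      using assms(17) j iS that unfolding maximal_def U_def by blast
    then show ?thesis
      by (simp add: mean_curvature_def shape_operator_def[abs_def] hW P_def N'_def)
  qed
  have "1/2 * divergence (gM j) (gradient (gM j) ((\<lambda>q. (sinh (\<phi> q))\<^sup>2) \<circ> param M j)) x \<ge>
    ((real CARD('n) + 1) * (deriv f (fst (P x)))\<^sup>2 / (f (fst (P x)))\<^sup>2
      - real CARD('n) * deriv (deriv f) (fst (P x)) / f (fst (P x))) * ((fst (N' x))\<^sup>2 - 1)\<^sup>2"
    by (rule X.laplacian_inequality_maximal[OF x assms(3) flat ncc max]) (simp_all add: gM_eq hW sinh)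
  moreover have "(fst (N' x))\<^sup>2 - 1 = (sinh (\<phi> p))\<^sup>2"
    using sinh[OF x] parD[OF pD] by (simp add: x_def)
  then have "((fst (N' x))\<^sup>2 - 1)\<^sup>2 = (sinh (\<phi> p)) ^ 4"
    by (simp flip: power_mult)
  ultimately show "let n = real CARD('n); \<tau> = fst (\<psi> p) in
      1/2 * laplacian M gM j (\<lambda>q. (sinh (\<phi> q))\<^sup>2) p
        \<ge> ((n + 1) * (deriv f \<tau>)\<^sup>2 / (f \<tau>)\<^sup>2 - n * deriv (deriv f) \<tau> / f \<tau>) * (sinh (\<phi> p)) ^ 4"
    unfolding Let_def laplacian_def x_def[symmetric] Px by simp
qed

end
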